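(* Let $\Bbbk$ be a field of characteristic different from $2$ and $3$ and let $A=\mathrm{FK}(3)$ be the Fomin–Kirillov algebra on $3$ generators over $\Bbbk$. There is no generator of the Gerstenhaber bracket on the Hochschild cohomology $\operatorname{HH}^\bullet(A)$, i.e. there is no ($\Bbbk$-linear) map $\Delta:\operatorname{HH}^\bullet(A)\to\operatorname{HH}^\bullet(A)$ of degree $-1$ such that $$[x,y]=(-1)^{|x|}\big(\Delta(xy)-\Delta(x)y-(-1)^{|x|}x\Delta(y)\big)$$ for all homogeneous $x,y\in\operatorname{HH}^\bullet(A)$, where $|x|$ is the cohomological degree of $x$. In particular, there is no Batalin–Vilkovisky structure on $\operatorname{HH}^\bullet(A)$ inducing the Gerstenhaber bracket.
   Context: $\mathrm{FK}(3)$ is the $\Bbbk$-algebra generated by $a,b,c$ subject to $a^2=b^2=c^2=0$, $ab+bc+ca=0$, $ba+ac+cb=0$. A Batalin–Vilkovisky structure inducing the bracket is a $\Bbbk$-linear map $\Delta$ of degree $-1$ with $\Delta^2=0$ satisfying the displayed identity. $\operatorname{HH}^\bullet(A)$ is the cohomology of the Hochschild cochain complex $\operatorname{Hom}_\Bbbk(A^{\otimes\bullet},A)\cong\operatorname{Hom}_{A^e}(B_\bullet(A),A)$, where $B_n(A)=A^{\otimes(n+2)}$ is the bar resolution. The product $xy$ is the cup product, given at the cochain level by $(f\cup g)(a_1,\dots,a_{m+n})=f(a_1,\dots,a_m)g(a_{m+1},\dots,a_{m+n})$ (no sign). The Gerstenhaber bracket is induced by $[f,g]=f\circ_Gg-(-1)^{(m-1)(n-1)}g\circ_Gf$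 for $f\in\operatorname{Hom}_\Bbbk(A^{\otimes m},A)$, $g\in\operatorname{Hom}_\Bbbk(A^{\otimes n},A)$, where $$(f\circ_Gg)(a_1|\dots|a_{m+n-1})=\sum_{i=1}^m(-1)^{(n-1)(i-1)}f(a_1|\dots|a_{i-1}|g(a_i|\dots|a_{i+n-1})|a_{i+n}|\dots|a_{m+n-1})$$ (vertical bars denote tensor products; $f\circ_Gg=0$ if $m=0$, and $g(1)$ is inserted if $n=0$). *)

theory Defs
  imports Complex_Main "HOL-Library.Poly_Mapping" "HOL-Computational_Algebra.Primes"
begin

section \<open>The Fomin--Kirillov algebra on three generators\<close>

datatype fk3_gen = Gen_a | Gen_b | Gen_c

text \<open>Words form a monoid under concatenation, written additively because
  \<^typ>\<open>'m \<Rightarrow>\<^sub>0 'k\<close> is the monoid algebra of an additive monoid \<^typ>\<open>'m\<close>.\<close>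

datatype fk3_word = Word (letters: "fk3_gen list")

instantiation fk3_word :: monoid_add
begin

definition "0 = Word []"

definition "u + v = Word (letters u @ letters v)"

instance
  by standard (simp_all add: zero_fk3_word_def plus_fk3_word_def)

end

lemma fk3_word_add_eq_0_iff: "(u :: fk3_word) + v = 0 \<longleftrightarrow> u = 0 \<and> v = 0"
  by (cases u; cases v) (auto simp: zero_fk3_word_def plus_fk3_word_def)

text \<open>The free algebra \<open>'k\<langle>a, b, c\<rangle>\<close>.\<close>

type_synonym 'k fk3_free = "fk3_word \<Rightarrow>\<^sub>0 'k"

definition fk3_var :: "fk3_gen \<Rightarrow> 'k::field fk3_free"
  where "fk3_var g = Poly_Mapping.single (Word [g]) 1"

definition fk3_relators :: "'k::field fk3_free set"
  where "fk3_relators =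
    (let a = fk3_var Gen_a; b = fk3_var Gen_b; c = fk3_var Gen_c
     in {a * a, b * b, c * c, a * b + b * c + c * a, b * a + a * c + c * b})"

inductive_set fk3_ideal :: "'k::field fk3_free set"
  where
    relator: "r \<in> fk3_relators \<Longrightarrow> r \<in> fk3_ideal"
  | zero: "0 \<in> fk3_ideal"
  | add: "p \<in> fk3_ideal \<Longrightarrow> q \<in> fk3_ideal \<Longrightarrow> p + q \<in> fk3_ideal"
  | mult: "p \<in> fk3_ideal \<Longrightarrow> u * p * v \<in> fk3_ideal"

lemma fk3_ideal_mult_left: "p \<in> fk3_ideal \<Longrightarrow> u * p \<in> fk3_ideal"
  using fk3_ideal.mult[of p u 1] by simp

lemma fk3_ideal_mult_right: "p \<in> fk3_ideal \<Longrightarrow> p * v \<in> fk3_ideal"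
  using fk3_ideal.mult[of p 1 v] by simp

lemma fk3_ideal_minus: "p \<in> fk3_ideal \<Longrightarrow> - p \<in> fk3_ideal"
  using fk3_ideal_mult_left[of p "- 1"] by simp

lemma lookup_mult_empty_word:
  fixes p q :: "'k::field fk3_free"
  shows "Poly_Mapping.lookup (p * q) 0 = Poly_Mapping.lookup p 0 * Poly_Mapping.lookup q 0"
proof -
  have "Sum_any (\<lambda>v. Poly_Mapping.lookup q v when 0 = u + v) = (Poly_Mapping.lookup q 0 when u = 0)" for u
    by (cases "u = 0") (auto simp: when_def eq_commute[of 0] fk3_word_add_eq_0_iff)
  then show ?thesis
    by (simp add: lookup_mult mult_when)
qed

lemma lookup_fk3_ideal_empty_word: "p \<in> fk3_ideal \<Longrightarrow> Poly_Mapping.lookup p 0 = 0"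
proof (induction rule: fk3_ideal.induct)
  case (relator r)
  have "Poly_Mapping.lookup (fk3_var g :: 'a fk3_free) 0 = 0" for g
    by (simp add: fk3_var_def lookup_single when_def zero_fk3_word_def)
  with relator show ?case
    by (auto simp: fk3_relators_def Let_def lookup_mult_empty_word lookup_add)
qed (simp_all add: lookup_mult_empty_word lookup_add)

definition fk3_rel :: "'k::field fk3_free \<Rightarrow> 'k fk3_free \<Rightarrow> bool"
  where "fk3_rel p q \<longleftrightarrow> p - q \<in> fk3_ideal"

lemma equivp_fk3_rel: "equivp (fk3_rel :: 'k::field fk3_free \<Rightarrow> _)"
proof (rule equivpI)
  show "reflp (fk3_rel :: 'k fk3_free \<Rightarrow> _)"
    by (simp add: reflp_def fk3_rel_def fk3_ideal.zero)
  show "symp (fk3_rel :: 'k fk3_free \<Rightarrow> _)"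
    using fk3_ideal_minus by (force simp: symp_def fk3_rel_def)
  show "transp (fk3_rel :: 'k fk3_free \<Rightarrow> _)"
  proof (rule transpI)
    fix p q r :: "'k fk3_free"
    assume "fk3_rel p q" "fk3_rel q r"
    then show "fk3_rel p r"
      using fk3_ideal.add[of "p - q" "q - r"] by (simp add: fk3_rel_def)
  qed
qed

lemma fk3_rel_refl: "fk3_rel p p"
  using equivp_fk3_rel by (rule equivp_reflp)

quotient_type (overloaded) 'k fk3 = "'k::field fk3_free" / fk3_rel
  by (rule equivp_fk3_rel)

instantiation fk3 :: (field) ring_1
begin

lift_definition zero_fk3 :: "'a fk3" is 0 .

lift_definition one_fk3 :: "'a fk3" is 1 .

lift_definition plus_fk3 :: "'a fk3 \<Rightarrow> 'a fk3 \<Rightarrow> 'a fk3" is "(+)"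
  unfolding fk3_rel_def add_diff_add by (rule fk3_ideal.add)

lift_definition uminus_fk3 :: "'a fk3 \<Rightarrow> 'a fk3" is uminus
  unfolding fk3_rel_def minus_diff_minus by (rule fk3_ideal_minus)

lift_definition minus_fk3 :: "'a fk3 \<Rightarrow> 'a fk3 \<Rightarrow> 'a fk3" is "(-)"
proof -
  fix p p' q q' :: "'a fk3_free"
  assume "fk3_rel p p'" "fk3_rel q q'"
  moreover have "p - q - (p' - q') = (p - p') + - (q - q')"
    by simp
  ultimately show "fk3_rel (p - q) (p' - q')"
    unfolding fk3_rel_def by (metis fk3_ideal.add fk3_ideal_minus)
qed

lift_definition times_fk3 :: "'a fk3 \<Rightarrow> 'a fk3 \<Rightarrow> 'a fk3" is "(*)"
proof -
  fix p p' q q' :: "'a fk3_free"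
  assume "fk3_rel p p'" "fk3_rel q q'"
  moreover have "p * q - p' * q' = (p - p') * q + p' * (q - q')"
    by (simp add: algebra_simps)
  ultimately show "fk3_rel (p * q) (p' * q')"
    unfolding fk3_rel_def
    by (simp add: fk3_ideal.add fk3_ideal_mult_left fk3_ideal_mult_right)
qed

instance
proof
  show "(0 :: 'a fk3) \<noteq> 1"
  proof (transfer, rule notI)
    assume "fk3_rel 0 (1 :: 'a fk3_free)"
    then have "Poly_Mapping.lookup (0 - 1 :: 'a fk3_free) 0 = 0"
      unfolding fk3_rel_def by (rule lookup_fk3_ideal_empty_word)
    then show False
      by (simp add: lookup_minus lookup_one)
  qed
qed (transfer; simp add: fk3_rel_refl ac_simps distrib_left distrib_right)+

end

text \<open>\<open>single 0 s\<close> is the scalar \<open>s\<close> times the empty word.\<close>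

lift_definition fk3_scale :: "'k::field \<Rightarrow> 'k fk3 \<Rightarrow> 'k fk3"
  is "\<lambda>s p. Poly_Mapping.single 0 s * p"
  unfolding fk3_rel_def right_diff_distrib[symmetric] by (rule fk3_ideal_mult_left)

locale algebra_over_field = vector_space scale
  for scale :: "'k::field \<Rightarrow> 'a::ring_1 \<Rightarrow> 'a" +
  assumes scale_mult_left: "scale s x * y = scale s (x * y)"
    and scale_mult_right: "x * scale s y = scale s (x * y)"

lemma single_0_mult_commute:
  "p * Poly_Mapping.single 0 s = Poly_Mapping.single 0 s * p" for p :: "'k::field fk3_free"
proof (induction p rule: update_induct)
  case const
  show ?case by simp
next
  case (update f w t)
  have "Poly_Mapping.update w t f = Poly_Mapping.single w t + f"
    using update(1)
    by (intro poly_mapping_eqI)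
      (auto simp: lookup_update lookup_add lookup_single when_def in_keys_iff)
  with update show ?case
    by (simp add: mult_single mult.commute distrib_left distrib_right)
qed

global_interpretation fk3: algebra_over_field "fk3_scale :: 'k::field \<Rightarrow> 'k fk3 \<Rightarrow> 'k fk3"
proof
  fix s t :: 'k and x y :: "'k fk3"
  show "fk3_scale s (x + y) = fk3_scale s x + fk3_scale s y"
    by transfer (simp add: fk3_rel_refl distrib_left)
  show "fk3_scale (s + t) x = fk3_scale s x + fk3_scale t x"
    by transfer (simp add: fk3_rel_refl distrib_right single_add)
  show "fk3_scale s (fk3_scale t x) = fk3_scale (s * t) x"
    by transfer (simp add: fk3_rel_refl mult_single flip: mult.assoc)
  show "fk3_scale 1 x = x"
    by transfer (simp add: fk3_rel_refl)
  show "fk3_scale s x * y = fk3_scale s (x * y)"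
    by transfer (simp add: fk3_rel_refl mult.assoc)
  show "x * fk3_scale s y = fk3_scale s (x * y)"
  proof transfer
    fix s and x y :: "'k fk3_free"
    have "x * (Poly_Mapping.single 0 s * y) = Poly_Mapping.single 0 s * (x * y)"
      by (metis mult.assoc single_0_mult_commute)
    then show "fk3_rel (x * (Poly_Mapping.single 0 s * y)) (Poly_Mapping.single 0 s * (x * y))"
      by (simp add: fk3_rel_refl)
  qed
qed


section \<open>The Hochschild complex\<close>

text \<open>
  A linear map \<open>A\<^bsup>\<otimes>n\<^esup> \<rightarrow> A\<close> is encoded as the corresponding \<open>n\<close>-linear map, that is as a function
  on lists of length \<open>n\<close>. A function on all lists therefore collects one component for each arity;
  the total complex \<open>\<Oplus>\<^sub>n Hom(A\<^bsup>\<otimes>n\<^esup>, A)\<close> consists of those with only finitely many nonzero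
  components, each of them multilinear.
\<close>

type_synonym 'a cochain = "'a list \<Rightarrow> 'a"

definition multilinear :: "('k::field \<Rightarrow> 'a::ring_1 \<Rightarrow> 'a) \<Rightarrow> 'a cochain \<Rightarrow> bool"
  where "multilinear scale f \<longleftrightarrow>
    (\<forall>us ws s x y. f (us @ (scale s x + y) # ws) = scale s (f (us @ x # ws)) + f (us @ y # ws))"

definition homogeneous :: "nat \<Rightarrow> 'a::zero cochain \<Rightarrow> bool"
  where "homogeneous n f \<longleftrightarrow> (\<forall>xs. length xs \<noteq> n \<longrightarrow> f xs = 0)"

definition cochains :: "('k::field \<Rightarrow> 'a::ring_1 \<Rightarrow> 'a) \<Rightarrow> 'a cochain set"
  where "cochains scale = {f. multilinear scale f \<and> (\<exists>N. \<forall>xs. N < length xs \<longrightarrow> f xs = 0)}"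

text \<open>The differential is the one dual to that of the bar resolution:
  \<open>(df)(a\<^sub>1|\<dots>|a\<^sub>n\<^sub>+\<^sub>1) = a\<^sub>1 f(a\<^sub>2|\<dots>|a\<^sub>n\<^sub>+\<^sub>1) + \<Sum>\<^sub>1\<^sub>\<le>\<^sub>i\<^sub>\<le>\<^sub>n (-1)\<^sup>i f(a\<^sub>1|\<dots>|a\<^sub>i a\<^sub>i\<^sub>+\<^sub>1|\<dots>|a\<^sub>n\<^sub>+\<^sub>1)
  + (-1)\<^sup>n\<^sup>+\<^sup>1 f(a\<^sub>1|\<dots>|a\<^sub>n) a\<^sub>n\<^sub>+\<^sub>1\<close>. List positions start at \<open>0\<close>.\<close>

definition coboundary :: "'a::ring_1 cochain \<Rightarrow> 'a cochain"
  where "coboundary f xs =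
    (if xs = [] then 0
     else hd xs * f (tl xs)
       + (\<Sum>i<length xs - 1. (-1) ^ (i + 1) * f (take i xs @ (xs ! i * xs ! (i + 1)) # drop (i + 2) xs))
       + (-1) ^ length xs * f (butlast xs) * last xs)"

definition cup :: "'a::ring_1 cochain \<Rightarrow> 'a cochain \<Rightarrow> 'a cochain"
  where "cup f g xs = (\<Sum>i\<le>length xs. f (take i xs) * g (drop i xs))"

text \<open>\<open>gerst_circ m n f g\<close> is \<open>f \<circ>\<^sub>G g\<close> for the components of \<open>f\<close> and \<open>g\<close> of arities \<open>m\<close>
  and \<open>n\<close>. The index \<open>i\<close> is shifted by one, and \<open>n + 1\<close>, \<open>m + 1\<close> replace \<open>n - 1\<close>, \<open>m - 1\<close> in the
  exponents, which changes no parity and avoids truncated subtraction.\<close>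

definition gerst_circ :: "nat \<Rightarrow> nat \<Rightarrow> 'a::ring_1 cochain \<Rightarrow> 'a cochain \<Rightarrow> 'a cochain"
  where "gerst_circ m n f g xs =
    (if length xs + 1 = m + n
     then \<Sum>i<m. (-1) ^ ((n + 1) * i) * f (take i xs @ g (take n (drop i xs)) # drop (i + n) xs)
     else 0)"

definition gerst_bracket :: "'a::ring_1 cochain \<Rightarrow> 'a cochain \<Rightarrow> 'a cochain"
  where "gerst_bracket f g xs =
    (\<Sum>(m, n) | m + n = length xs + 1.
      gerst_circ m n f g xs - (-1) ^ ((m + 1) * (n + 1)) * gerst_circ n m g f xs)"

definition cocycles :: "('k::field \<Rightarrow> 'a::ring_1 \<Rightarrow> 'a) \<Rightarrow> 'a cochain set"
  where "cocycles scale = {f \<in> cochains scale. coboundary f = (\<lambda>xs. 0)}"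

definition coboundaries :: "('k::field \<Rightarrow> 'a::ring_1 \<Rightarrow> 'a) \<Rightarrow> 'a cochain set"
  where "coboundaries scale = coboundary ` cochains scale"


section \<open>Compatibility of the operations with the differential\<close>

subsection \<open>Sums over decompositions of a list\<close>

fun split_sum :: "('a list \<Rightarrow> 'a list \<Rightarrow> 'b::comm_monoid_add) \<Rightarrow> 'a list \<Rightarrow> 'b"
  where
    "split_sum F [] = F [] []"
  | "split_sum F (x # xs) = F [] (x # xs) + split_sum (\<lambda>u v. F (x # u) v) xs"

lemma split_sum_index: "split_sum F xs = (\<Sum>i\<le>length xs. F (take i xs) (drop i xs))"
  by (induction xs arbitrary: F) (simp_all add: sum.atMost_Suc_shift del: sum.atMost_Suc)

lemma split_sum_cong:
  "(\<And>u v. u @ v = xs \<Longrightarrow> F u v = G u v) \<Longrightarrow> split_sum F xs = split_sum G xs"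
  by (simp add: split_sum_index)

lemma split_sum_add: "split_sum (\<lambda>u v. F u v + G u v) xs = split_sum F xs + split_sum G xs"
  by (simp add: split_sum_index sum.distrib)

lemma split_sum_0: "split_sum (\<lambda>u v. 0) xs = 0"
  by (simp add: split_sum_index)

lemma split_sum_hom:
  assumes "\<And>x y. h (x + y) = h x + h y" and "h 0 = 0"
  shows "h (split_sum F xs) = split_sum (\<lambda>u v. h (F u v)) xs"
  by (induction xs arbitrary: F) (simp_all add: assms)

lemma split_sum_mult_left: "split_sum (\<lambda>u v. (c :: 'b::ring_1) * F u v) xs = c * split_sum F xs"
  by (simp add: split_sum_index sum_distrib_left)

lemma split_sum_mult_right: "split_sum (\<lambda>u v. F u v * (c :: 'b::ring_1)) xs = split_sum F xs * c"
  by (simp add: split_sum_index sum_distrib_right)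

lemma split_sum_diff:
  "split_sum (\<lambda>u v. F u v - G u v :: 'b::ring_1) xs = split_sum F xs - split_sum G xs"
  by (simp add: split_sum_index sum_subtractf)

lemma split_sum_append_Cons:
  "split_sum F (a @ z # b) =
    split_sum (\<lambda>u v. F u (v @ z # b)) a + split_sum (\<lambda>u v. F (a @ z # u) v) b"
  by (induction a arbitrary: F) (simp_all add: add.assoc)

lemma split_sum_assoc:
  "split_sum (\<lambda>u r. split_sum (F u) r) xs = split_sum (\<lambda>l w. split_sum (\<lambda>u v. F u v w) l) xs"
  by (induction xs arbitrary: F) (simp_all add: split_sum_add add.assoc)

lemma split_sum_eq_0: "(\<And>u v. u @ v = xs \<Longrightarrow> F u v = 0) \<Longrightarrow> split_sum F xs = 0"
  by (simp add: split_sum_index)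

lemma split_sum_swap:
  "split_sum (\<lambda>u v. split_sum (F u v) ys) xs = split_sum (\<lambda>a b. split_sum (\<lambda>u v. F u v a b) xs) ys"
  unfolding split_sum_index by (rule sum.swap)

lemma split_sum_Nil: "(\<And>u v. u \<noteq> [] \<Longrightarrow> F u v = 0) \<Longrightarrow> split_sum F xs = F [] xs"
  by (cases xs) (simp_all add: split_sum_eq_0)

lemma split_sum_snoc: "split_sum F (xs @ [x]) = split_sum (\<lambda>u v. F u (v @ [x])) xs + F (xs @ [x]) []"
  by (simp add: split_sum_append_Cons)

lemma split_sum_Nil_right: "(\<And>u v. v \<noteq> [] \<Longrightarrow> F u v = 0) \<Longrightarrow> split_sum F xs = F xs []"
  by (cases xs rule: rev_cases) (simp_all add: split_sum_snoc split_sum_eq_0)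

lemma split_sum_shift:
  "split_sum (\<lambda>u v. if u = [] then 0 else F (butlast u) (last u) v) xs =
   split_sum (\<lambda>u v. if v = [] then 0 else F u (hd v) (tl v)) xs"
proof (induction xs arbitrary: F)
  case Nil
  show ?case by simp
next
  case (Cons x xs)
  have "split_sum (\<lambda>u v. if u = [] then 0 else F (butlast u) (last u) v) (x # xs) =
    split_sum (\<lambda>u v. (if u = [] then F [] x v else 0)
      + (if u = [] then 0 else F (x # butlast u) (last u) v)) xs"
    by (auto intro!: split_sum_cong)
  also have "\<dots> = F [] x xs + split_sum (\<lambda>u v. if v = [] then 0 else F (x # u) (hd v) (tl v)) xs"
    by (simp add: split_sum_add split_sum_Nil Cons[of "\<lambda>u. F (x # u)"])
  finally show ?case
    by simp
qed

definition split_sum3 ::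
    "('a list \<Rightarrow> 'a list \<Rightarrow> 'a list \<Rightarrow> 'b::comm_monoid_add) \<Rightarrow> 'a list \<Rightarrow> 'b"
  where "split_sum3 F xs = split_sum (\<lambda>u r. split_sum (F u) r) xs"

lemma split_sum3_append_Cons:
  "split_sum3 F (a @ z # b) =
    split_sum3 (\<lambda>u v w. F u v (w @ z # b)) a
    + split_sum (\<lambda>u r. split_sum (\<lambda>v w. F u (r @ z # v) w) b) a
    + split_sum3 (\<lambda>u v w. F (a @ z # u) v w) b"
  by (simp add: split_sum3_def split_sum_append_Cons split_sum_add)

lemma split_sum3_cong:
  "(\<And>u v w. u @ v @ w = xs \<Longrightarrow> F u v w = G u v w) \<Longrightarrow> split_sum3 F xs = split_sum3 G xs"
  unfolding split_sum3_def by (auto intro!: split_sum_cong)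

lemma split_sum3_eq_0:
  "(\<And>u v w. u @ v @ w = xs \<Longrightarrow> F u v w = 0) \<Longrightarrow> split_sum3 F xs = 0"
  unfolding split_sum3_def by (auto intro!: split_sum_eq_0)

lemma split_sum3_add:
  "split_sum3 (\<lambda>u v w. F u v w + G u v w) xs = split_sum3 F xs + split_sum3 G xs"
  by (simp add: split_sum3_def split_sum_add)

lemma split_sum3_diff:
  "split_sum3 (\<lambda>u v w. F u v w - G u v w :: 'b::ring_1) xs = split_sum3 F xs - split_sum3 G xs"
  by (simp add: split_sum3_def split_sum_diff)

lemma split_sum3_0: "split_sum3 (\<lambda>u v w. 0) xs = 0"
  by (simp add: split_sum3_def split_sum_0)

lemma split_sum3_mult_left:
  "split_sum3 (\<lambda>u v w. (c :: 'b::ring_1) * F u v w) xs = c * split_sum3 F xs"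
  by (simp add: split_sum3_def split_sum_mult_left)

lemma split_sum3_hom:
  assumes "\<And>x y. h (x + y) = h x + h y" and "h 0 = 0"
  shows "h (split_sum3 F xs) = split_sum3 (\<lambda>u v w. h (F u v w)) xs"
  by (simp add: split_sum3_def split_sum_hom[of h, OF assms])

lemma split_sum3_index:
  assumes "\<And>u v w. length v \<noteq> n \<Longrightarrow> F u v w = 0"
  shows "split_sum3 F xs =
    (\<Sum>i<length xs + 1 - n. F (take i xs) (take n (drop i xs)) (drop (i + n) xs))"
proof -
  have inner: "split_sum (F u) r = (if n \<le> length r then F u (take n r) (drop n r) else 0)" for u r
  proof -
    have "split_sum (F u) r = (\<Sum>i\<le>length r. if i = n then F u (take n r) (drop n r) else 0)"
      unfolding split_sum_index by (rule sum.cong) (auto simp: assms)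
    then show ?thesis by simp
  qed
  show ?thesis
    unfolding split_sum3_def inner split_sum_index[of "\<lambda>u r. if n \<le> length r then _ u r else _ u r"]
    by (rule sum.mono_neutral_cong_right) (auto simp: add.commute)
qed

subsection \<open>The insertion operation\<close>

text \<open>\<open>insertion f g\<close> is \<open>f \<circ>\<^sub>G g\<close>, summed over all arities.\<close>

definition insertion :: "'a::ring_1 cochain \<Rightarrow> 'a cochain \<Rightarrow> 'a cochain"
  where "insertion f g =
    split_sum3 (\<lambda>u v w. (-1) ^ ((length v + 1) * length u) * f (u @ g v # w))"

text \<open>Both arguments are inserted into disjoint blocks, the first of them to the left.\<close>

definition insertion2 :: "'a::ring_1 cochain \<Rightarrow> 'a cochain \<Rightarrow> 'a cochain \<Rightarrow> 'a cochain"
  where "insertion2 h f g =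
    split_sum (\<lambda>u r. split_sum (\<lambda>v r. split_sum3 (\<lambda>w b e.
      (-1) ^ ((length v + 1) * length u + (length b + 1) * (length u + 1 + length w))
        * h (u @ f v # w @ g b # e)) r) r)"

definition mult_cochain :: "'a::ring_1 cochain"
  where "mult_cochain xs = (case xs of [x, y] \<Rightarrow> x * y | _ \<Rightarrow> 0)"

definition shift_sign :: "'a::ring_1 cochain \<Rightarrow> 'a cochain"
  where "shift_sign f xs = (-1) ^ (length xs + 1) * f xs"

definition component :: "nat \<Rightarrow> 'a::zero cochain \<Rightarrow> 'a cochain"
  where "component n f xs = (if length xs = n then f xs else 0)"

lemma homogeneous_component: "homogeneous n (component n f)"
  by (simp add: homogeneous_def component_def)

lemma homogeneous_mult_cochain: "homogeneous 2 mult_cochain"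
  by (auto simp: homogeneous_def mult_cochain_def split: list.splits)

lemma neg_one_power_mult_commute: "(-1 :: 'a::ring_1) ^ k * x = x * (-1) ^ k"
  by (cases "even k") auto

lemma neg_one_power_left_commute: "y * ((-1 :: 'a::ring_1) ^ k * x) = (-1) ^ k * (y * x)"
  by (cases "even k") auto

lemma neg_one_power_cong: "even m = even n \<Longrightarrow> (-1 :: 'a::ring_1) ^ m = (-1) ^ n"
  by (cases "even m") auto

context algebra_over_field
begin

lemma multilinearD_add:
  assumes "multilinear scale f"
  shows "f (us @ (x + y) # ws) = f (us @ x # ws) + f (us @ y # ws)"
  using assms[unfolded multilinear_def, rule_format, of us 1 x y ws] by simp

lemma multilinearD_0:
  assumes "multilinear scale f"
  shows "f (us @ 0 # ws) = 0"
  using multilinearD_add[OF assms, of us 0 0 ws] by simp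

lemma multilinearD_minus:
  assumes "multilinear scale f"
  shows "f (us @ (- x) # ws) = - f (us @ x # ws)"
  using multilinearD_add[OF assms, of us x "- x" ws] multilinearD_0[OF assms, of us ws]
  by (simp add: eq_neg_iff_add_eq_0 add.commute)

lemma multilinearD_diff:
  assumes "multilinear scale f"
  shows "f (us @ (x - y) # ws) = f (us @ x # ws) - f (us @ y # ws)"
  using multilinearD_add[OF assms, of us x "- y" ws] multilinearD_minus[OF assms, of us y ws]
  by simp

lemma multilinearD_sign:
  assumes "multilinear scale f"
  shows "f (us @ ((-1) ^ k * x) # ws) = (-1) ^ k * f (us @ x # ws)"
  using multilinearD_minus[OF assms] by (cases "even k") auto

lemma scale_sign: "(-1) ^ k * scale s x = scale s ((-1) ^ k * x)"
  by (rule scale_mult_right)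

lemma multilinear_mult_cochain: "multilinear scale mult_cochain"
proof -
  have "mult_cochain (us @ (scale s x + y) # ws) =
    scale s (mult_cochain (us @ x # ws)) + mult_cochain (us @ y # ws)" for us ws s x y
    by (cases us rule: remdups_adj.cases; cases ws)
      (auto simp: mult_cochain_def scale_mult_left scale_mult_right distrib_left distrib_right
        split: list.splits)
  then show ?thesis
    by (simp add: multilinear_def)
qed

lemma multilinear_shift_sign: "multilinear scale f \<Longrightarrow> multilinear scale (shift_sign f)"
  by (simp add: multilinear_def shift_sign_def distrib_left scale_mult_right
      scale_right_distrib scale_minus_right)

lemma multilinear_component: "multilinear scale f \<Longrightarrow> multilinear scale (component n f)"
  by (simp add: multilinear_def component_def)

lemma multilinear_add:
  "multilinear scale f \<Longrightarrow> multilinear scale g \<Longrightarrow> multilinear scale (\<lambda>xs. f xs + g xs)"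
  by (simp add: multilinear_def scale_right_distrib)

lemma multilinear_scale: "multilinear scale f \<Longrightarrow> multilinear scale (\<lambda>xs. scale s (f xs))"
  by (simp add: multilinear_def scale_right_distrib mult.commute)

lemma multilinear_minus: "multilinear scale f \<Longrightarrow> multilinear scale (\<lambda>xs. - f xs)"
  by (simp add: multilinear_def)

lemma multilinear_diff:
  "multilinear scale f \<Longrightarrow> multilinear scale g \<Longrightarrow> multilinear scale (\<lambda>xs. f xs - g xs)"
  by (simp add: multilinear_def scale_right_diff_distrib)

lemma split_sum_scale: "split_sum (\<lambda>u v. scale s (F u v)) xs = scale s (split_sum F xs)"
  by (simp add: split_sum_index scale_sum_right)

lemma split_sum3_scale: "split_sum3 (\<lambda>u v w. scale s (F u v w)) xs = scale s (split_sum3 F xs)"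
  by (simp add: split_sum3_def split_sum_scale)

lemma multilinear_cup:
  assumes "multilinear scale f" "multilinear scale g"
  shows "multilinear scale (cup f g)"
  unfolding multilinear_def
proof (intro allI)
  fix us ws s x y
  have cup: "cup f g (us @ z # ws) =
    split_sum (\<lambda>u v. f u * g (v @ z # ws)) us + split_sum (\<lambda>u v. f (us @ z # u) * g v) ws" for z
    unfolding cup_def split_sum_index[of "\<lambda>u v. f u * g v", symmetric]
    by (simp add: split_sum_append_Cons)
  show "cup f g (us @ (scale s x + y) # ws) = scale s (cup f g (us @ x # ws)) + cup f g (us @ y # ws)"
    unfolding cup
    using assms by (simp add: multilinear_def distrib_left distrib_right scale_mult_left
        scale_mult_right split_sum_add split_sum_scale scale_right_distrib)
qed

lemma multilinear_insertion:
  assumes "multilinear scale f" "multilinear scale g"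
  shows "multilinear scale (insertion f g)"
  unfolding multilinear_def
proof (intro allI)
  fix us ws s x y
  have 1: "f (u @ t # w @ (scale s x + y) # ws) =
      scale s (f (u @ t # w @ x # ws)) + f (u @ t # w @ y # ws)" for u t w
    using assms(1)[unfolded multilinear_def, rule_format, of "u @ t # w"] by simp
  have 2: "f (us @ (scale s x + y) # u @ t # w) =
      scale s (f (us @ x # u @ t # w)) + f (us @ y # u @ t # w)" for u t w
    using assms(1) by (simp add: multilinear_def)
  have 3: "f (u @ g (r @ (scale s x + y) # v) # w) =
      scale s (f (u @ g (r @ x # v) # w)) + f (u @ g (r @ y # v) # w)" for u r v w
    using assms by (simp add: multilinear_def)
  show "insertion f g (us @ (scale s x + y) # ws) =
    scale s (insertion f g (us @ x # ws)) + insertion f g (us @ y # ws)"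
    unfolding insertion_def split_sum3_append_Cons
    by (simp add: 1 2 3 distrib_left scale_mult_right split_sum_add split_sum3_add
        split_sum_scale split_sum3_scale scale_right_distrib del: power_Suc mult_minus_left)
qed


lemma insertion_add_left: "insertion (\<lambda>xs. f xs + f' xs) g xs = insertion f g xs + insertion f' g xs"
  by (simp add: insertion_def distrib_left split_sum3_add del: power_Suc)

lemma insertion_diff_left: "insertion (\<lambda>xs. f xs - f' xs) g xs = insertion f g xs - insertion f' g xs"
  by (simp add: insertion_def right_diff_distrib split_sum3_diff del: power_Suc)

lemma insertion_sign_left: "insertion (\<lambda>xs. (-1) ^ k * f xs) g xs = (-1) ^ k * insertion f g xs"
  by (simp add: insertion_def neg_one_power_left_commute[of "(-1) ^ _"] split_sum3_mult_left
      del: power_Suc mult_minus_left)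

lemma insertion_diff_right:
  assumes "multilinear scale f"
  shows "insertion f (\<lambda>xs. g xs - g' xs) xs = insertion f g xs - insertion f g' xs"
  by (simp add: insertion_def right_diff_distrib split_sum3_diff multilinearD_diff[OF assms]
      del: power_Suc)

lemma insertion_sign_right:
  assumes "multilinear scale f"
  shows "insertion f (\<lambda>xs. (-1) ^ k * g xs) xs = (-1) ^ k * insertion f g xs"
  by (simp add: insertion_def neg_one_power_left_commute[of "(-1) ^ _"] split_sum3_mult_left
      multilinearD_sign[OF assms] del: power_Suc mult_minus_left)

lemma insertion_insertion:
  assumes h: "multilinear scale h" and f: "homogeneous m f" and g: "homogeneous n g"
  shows "insertion (insertion h f) g xs =
    (-1) ^ ((m + 1) * (n + 1)) * insertion2 h f g xs + insertion2 h g f xs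
    + insertion h (insertion f g) xs"
proof -
  define c :: "'a list \<Rightarrow> 'a list \<Rightarrow> 'a" where "c v u = (-1) ^ ((length v + 1) * length u)" for v u
  define F1 where "F1 = (\<lambda>u v w b e. c b (u @ v @ w) * (c v u * h (u @ f v # w @ g b # e)))"
  define F2 where "F2 = (\<lambda>u r b v w. c b (u @ r) * (c (r @ g b # v) u * h (u @ f (r @ g b # v) # w)))"
  define F3 where "F3 = (\<lambda>a b u v w. c b a * (c v (a @ g b # u) * h (a @ g b # u @ f v # w)))"
  have "insertion (insertion h f) g xs =
    split_sum3 (\<lambda>a b e.
      split_sum3 (\<lambda>u v w. F1 u v w b e) a
      + split_sum (\<lambda>u r. split_sum (\<lambda>v w. F2 u r b v w) e) a
      + split_sum3 (\<lambda>u v w. F3 a b u v w) e) xs"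
    unfolding insertion_def c_def[symmetric] split_sum3_append_Cons
      distrib_left split_sum3_mult_left[symmetric] split_sum_mult_left[symmetric]
    by (rule split_sum3_cong)
      (intro arg_cong2[of _ _ _ _ "(+)"] split_sum3_cong split_sum_cong, auto simp: F1_def F2_def F3_def)
  also have "\<dots> = split_sum3 (\<lambda>a b e. split_sum3 (\<lambda>u v w. F1 u v w b e) a) xs
    + split_sum3 (\<lambda>a b e. split_sum (\<lambda>u r. split_sum (\<lambda>v w. F2 u r b v w) e) a) xs
    + split_sum3 (\<lambda>a b e. split_sum3 (\<lambda>u v w. F3 a b u v w) e) xs"
    by (simp add: split_sum3_add)
  also have "split_sum3 (\<lambda>a b e. split_sum3 (\<lambda>u v w. F3 a b u v w) e) xs = insertion2 h g f xs"
    unfolding insertion2_def split_sum3_def F3_def c_def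
    by (intro split_sum_cong) (simp add: power_add mult.assoc)
  also have "split_sum3 (\<lambda>a b e. split_sum3 (\<lambda>u v w. F1 u v w b e) a) xs =
    split_sum (\<lambda>u r. split_sum (\<lambda>v r. split_sum3 (\<lambda>w b e. F1 u v w b e) r) r) xs"
    unfolding split_sum3_def by (simp only: split_sum_assoc)
  also have "\<dots> = (-1) ^ ((m + 1) * (n + 1)) * insertion2 h f g xs"
  proof -
    have "F1 u v w b e = (-1) ^ ((m + 1) * (n + 1)) *
      ((-1) ^ ((length v + 1) * length u + (length b + 1) * (length u + 1 + length w))
        * h (u @ f v # w @ g b # e))" for u v w b e
    proof (cases "length v = m \<and> length b = n")
      case True
      then show ?thesis
        unfolding F1_def c_def mult.assoc[symmetric] power_add[symmetric]
        by (intro arg_cong2[of _ _ _ _ "(*)"] neg_one_power_cong refl) auto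
    next
      case False
      then have "f v = 0 \<or> g b = 0"
        using f g by (auto simp: homogeneous_def)
      then have "h (u @ f v # w @ g b # e) = 0"
        using multilinearD_0[OF h, of u "w @ g b # e"] multilinearD_0[OF h, of "u @ f v # w" e] by auto
      then show ?thesis
        by (simp add: F1_def)
    qed
    then show ?thesis
      unfolding insertion2_def by (simp only: split_sum3_mult_left split_sum_mult_left)
  qed
  also have "split_sum3 (\<lambda>a b e. split_sum (\<lambda>u r. split_sum (\<lambda>v w. F2 u r b v w) e) a) xs =
    insertion h (insertion f g) xs"
  proof -
    have "insertion h (insertion f g) xs =
      split_sum3 (\<lambda>u q w. split_sum3 (\<lambda>r b v. F2 u r b v w) q) xs"
      unfolding insertion_def
    proof (rule split_sum3_cong)
      fix u q w
      have "h (u @ split_sum3 (\<lambda>u v w. (- 1) ^ ((length v + 1) * length u) * f (u @ g v # w)) q # w) =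
        split_sum3 (\<lambda>r b v. (- 1) ^ ((length b + 1) * length r) * h (u @ f (r @ g b # v) # w)) q"
        by (subst split_sum3_hom[of "\<lambda>z. h (u @ z # w)"])
          (simp_all add: multilinearD_add[OF h] multilinearD_0[OF h] multilinearD_sign[OF h]
            del: power_Suc mult_minus_left)
      then show "(- 1) ^ ((length q + 1) * length u) *
          h (u @ split_sum3 (\<lambda>u v w. (- 1) ^ ((length v + 1) * length u) * f (u @ g v # w)) q # w) =
        split_sum3 (\<lambda>r b v. F2 u r b v w) q"
        unfolding F2_def c_def mult.assoc[symmetric] power_add[symmetric]
        by (simp only: split_sum3_mult_left[symmetric] mult.assoc[symmetric] power_add[symmetric])
          (intro split_sum3_cong arg_cong2[of _ _ _ _ "(*)"] neg_one_power_cong refl, auto)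
    qed
    also have "\<dots> = split_sum3 (\<lambda>a b e. split_sum (\<lambda>u r. split_sum (\<lambda>v w. F2 u r b v w) e) a) xs"
    proof -
      have "split_sum3 (\<lambda>u q w. split_sum3 (\<lambda>r b v. F2 u r b v w) q) xs =
        split_sum (\<lambda>u s. split_sum (\<lambda>r s. split_sum (\<lambda>b s. split_sum (\<lambda>v w. F2 u r b v w) s) s) s) xs"
        unfolding split_sum3_def
          split_sum_assoc[of "\<lambda>r t w. split_sum (\<lambda>b v. F2 _ r b v w) t", symmetric]
          split_sum_assoc[of "\<lambda>b v w. F2 _ _ b v w", symmetric] ..
      also have "\<dots> = split_sum (\<lambda>a s. split_sum (\<lambda>u r.
          split_sum (\<lambda>b e. split_sum (\<lambda>v w. F2 u r b v w) e) s) a) xs"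
        by (rule split_sum_assoc)
      also have "\<dots> = split_sum3 (\<lambda>a b e.
          split_sum (\<lambda>u r. split_sum (\<lambda>v w. F2 u r b v w) e) a) xs"
        unfolding split_sum3_def
        by (rule split_sum_cong) (rule split_sum_swap)
      finally show ?thesis .
    qed
    finally show ?thesis ..
  qed
  finally show ?thesis
    by (simp only: add.assoc add.commute[of "insertion2 h g f xs"])
qed

lemma insertion_pre_Lie:
  assumes "multilinear scale h" "homogeneous m f" "homogeneous n g"
  shows "insertion (insertion h f) g xs - insertion h (insertion f g) xs =
    (-1) ^ ((m + 1) * (n + 1)) *
      (insertion (insertion h g) f xs - insertion h (insertion g f) xs)"
proof -
  have "(-1 :: 'a) ^ ((n + 1) * (m + 1)) = (-1) ^ ((m + 1) * (n + 1))"
    by (simp only: mult.commute)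
  moreover have "(-1 :: 'a) ^ k * ((-1) ^ k * x) = x" for k x
    by (cases "even k") auto
  ultimately show ?thesis
    unfolding insertion_insertion[OF assms] insertion_insertion[OF assms(1,3,2)]
    by (simp add: distrib_left del: power_Suc mult_minus_left)
qed

lemma insertion_mult_cochain:
  fixes f :: "'a cochain"
  shows "insertion mult_cochain (shift_sign f) xs =
    (if xs = [] then 0 else hd xs * f (tl xs) + (-1) ^ length xs * f (butlast xs) * last xs)"
proof (cases "xs = []")
  case True
  then show ?thesis
    by (simp add: insertion_def split_sum3_def mult_cochain_def)
next
  case False
  obtain y ys where xs: "xs = y # ys" using False by (cases xs) auto
  obtain zs z where xs': "xs = zs @ [z]" using False by (cases xs rule: rev_cases) auto
  define F :: "'a list \<Rightarrow> 'a list \<Rightarrow> 'a list \<Rightarrow> 'a" where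
    "F = (\<lambda>u v w. (-1) ^ ((length v + 1) * length u) * mult_cochain (u @ shift_sign f v # w))"
  have F0: "F u v w = 0" if "length u + length w \<noteq> 1" for u v w
    using that homogeneous_mult_cochain[unfolded homogeneous_def, rule_format,
        of "u @ shift_sign f v # w"]
    by (simp add: F_def)
  have "insertion mult_cochain (shift_sign f) xs = split_sum3 F xs"
    by (simp only: insertion_def F_def)
  also have "\<dots> = split_sum (F []) xs + split_sum (\<lambda>u r. split_sum (F (y # u)) r) ys"
    by (simp add: split_sum3_def xs)
  also have "split_sum (\<lambda>u r. split_sum (F (y # u)) r) ys = F [y] ys []"
    by (subst split_sum_Nil, rule split_sum_eq_0, simp add: F0)
      (subst split_sum_Nil_right, simp_all add: F0)
  also have "split_sum (F []) xs = F [] zs [z]"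
    unfolding xs' split_sum_snoc
    by (subst split_sum_Nil_right) (simp_all add: F0)
  also have "F [y] ys [] = hd xs * f (tl xs)"
    by (cases "even (length ys)") (simp_all add: F_def mult_cochain_def shift_sign_def xs)
  also have "F [] zs [z] = (-1) ^ length xs * f (butlast xs) * last xs"
    by (simp add: F_def mult_cochain_def shift_sign_def xs')
  finally show ?thesis
    using False by (simp only: add.commute if_False)
qed

lemma coboundary_eq_insertion:
  assumes f: "multilinear scale f"
  shows "coboundary f xs = insertion mult_cochain (shift_sign f) xs - insertion f mult_cochain xs"
proof (cases "xs = []")
  case True
  have "f [0] = 0" using multilinearD_0[OF f, of "[]" "[]"] by simp
  with True show ?thesis
    by (simp add: coboundary_def insertion_def split_sum3_def mult_cochain_def)
next
  case False
  have "insertion f mult_cochain xs =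
    (\<Sum>i<length xs - 1. (-1) ^ i * f (take i xs @ (xs ! i * xs ! (i + 1)) # drop (i + 2) xs))"
  proof -
    have "mult_cochain v = 0 \<or> length v = 2" for v :: "'a list"
      using homogeneous_mult_cochain by (auto simp: homogeneous_def)
    then have "insertion f mult_cochain xs = (\<Sum>i<length xs + 1 - 2.
      (-1) ^ ((length (take 2 (drop i xs)) + 1) * length (take i xs))
        * f (take i xs @ mult_cochain (take 2 (drop i xs)) # drop (i + 2) xs))"
      unfolding insertion_def
      by (intro split_sum3_index) (metis multilinearD_0[OF f] mult_zero_right)
    also have "\<dots> =
      (\<Sum>i<length xs - 1. (-1) ^ i * f (take i xs @ (xs ! i * xs ! (i + 1)) # drop (i + 2) xs))"
    proof (rule sum.cong)
      fix i
      assume "i \<in> {..<length xs - 1}"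
      then have i: "i + 1 < length xs" by simp
      then have "take 2 (drop i xs) = [xs ! i, xs ! (i + 1)]"
        by (simp add: Cons_nth_drop_Suc[symmetric] numeral_2_eq_2)
      with i show "(-1) ^ ((length (take 2 (drop i xs)) + 1) * length (take i xs))
          * f (take i xs @ mult_cochain (take 2 (drop i xs)) # drop (i + 2) xs) =
        (-1) ^ i * f (take i xs @ (xs ! i * xs ! (i + 1)) # drop (i + 2) xs)"
        by (intro arg_cong2[of _ _ _ _ "(*)"] neg_one_power_cong) (auto simp: mult_cochain_def)
    qed simp
    finally show ?thesis .
  qed
  with False show ?thesis
    by (simp add: coboundary_def insertion_mult_cochain sum_negf)
qed

lemma multilinear_coboundary:
  assumes "multilinear scale f"
  shows "multilinear scale (coboundary f)"
proof -
  have "coboundary f = (\<lambda>xs. insertion mult_cochain (shift_sign f) xs - insertion f mult_cochain xs)"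
    by (rule ext) (rule coboundary_eq_insertion[OF assms])
  with assms show ?thesis
    by (simp add: multilinear_diff multilinear_insertion multilinear_mult_cochain
        multilinear_shift_sign)
qed

end

lemma shift_sign_shift_sign: "shift_sign (shift_sign f) = f"
  by (rule ext) (simp add: shift_sign_def flip: mult.assoc power_add)

lemma cup_eq_split_sum: "cup f g = split_sum (\<lambda>u v. f u * g v)"
  by (rule ext) (simp add: cup_def split_sum_index)

lemma cup_assoc: "cup (cup f g) h = cup f (cup g h)"
  unfolding cup_eq_split_sum split_sum_mult_left[symmetric] split_sum_mult_right[symmetric] mult.assoc
  by (rule ext) (rule split_sum_assoc[symmetric])

lemma cup_add_left: "cup (\<lambda>xs. f xs + f' xs) g xs = cup f g xs + cup f' g xs"
  by (simp add: cup_def distrib_right sum.distrib)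

lemma cup_add_right: "cup f (\<lambda>xs. g xs + g' xs) xs = cup f g xs + cup f g' xs"
  by (simp add: cup_def distrib_left sum.distrib)

lemma cup_diff_left: "cup (\<lambda>xs. f xs - f' xs) g xs = cup f g xs - cup f' g xs"
  by (simp add: cup_def left_diff_distrib sum_subtractf)

lemma cup_diff_right: "cup f (\<lambda>xs. g xs - g' xs) xs = cup f g xs - cup f g' xs"
  by (simp add: cup_def right_diff_distrib sum_subtractf)

lemma coboundary_add: "coboundary (\<lambda>xs. f xs + g xs) xs = coboundary f xs + coboundary g xs"
  by (simp add: coboundary_def distrib_left distrib_right sum.distrib del: power_Suc)

lemma coboundary_diff: "coboundary (\<lambda>xs. f xs - g xs) xs = coboundary f xs - coboundary g xs"
  by (simp add: coboundary_def left_diff_distrib right_diff_distrib sum_subtractf del: power_Suc)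

lemma coboundary_0: "coboundary (\<lambda>xs. 0) = (\<lambda>xs. 0)"
  by (rule ext) (simp add: coboundary_def)

lemma coboundary_shift_sign: "coboundary (shift_sign f) xs = - shift_sign (coboundary f) xs"
proof (cases "xs = []")
  case False
  have "(\<Sum>i<length xs - 1. (-1) ^ (i + 1) *
      shift_sign f (take i xs @ (xs ! i * xs ! (i + 1)) # drop (i + 2) xs)) =
    (\<Sum>i<length xs - 1. (-1) ^ length xs *
      ((-1) ^ (i + 1) * f (take i xs @ (xs ! i * xs ! (i + 1)) # drop (i + 2) xs)))"
  proof (rule sum.cong)
    fix i
    assume "i \<in> {..<length xs - 1}"
    then have "length (take i xs @ (xs ! i * xs ! (i + 1)) # drop (i + 2) xs) + 1 = length xs"
      by simp
    then show "(-1) ^ (i + 1) *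
        shift_sign f (take i xs @ (xs ! i * xs ! (i + 1)) # drop (i + 2) xs) =
      (-1) ^ length xs * ((-1) ^ (i + 1) * f (take i xs @ (xs ! i * xs ! (i + 1)) # drop (i + 2) xs))"
      unfolding shift_sign_def by (simp only: neg_one_power_left_commute[of "(-1) ^ _"])
  qed simp
  moreover have "shift_sign f (tl xs) = (-1) ^ length xs * f (tl xs)"
    "shift_sign f (butlast xs) = (-1) ^ length xs * f (butlast xs)"
    using False by (simp_all add: shift_sign_def Suc_pred)
  ultimately show ?thesis
    using False
    by (cases "even (length xs)")
      (simp_all add: coboundary_def shift_sign_def sum_negf del: power_Suc)
qed (simp add: coboundary_def shift_sign_def)

context algebra_over_field
begin

lemma coboundary_scale: "coboundary (\<lambda>xs. scale s (f xs)) xs = scale s (coboundary f xs)"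
  by (simp add: coboundary_def scale_mult_left scale_mult_right scale_right_distrib scale_sum_right
      scale_sign del: power_Suc)

lemma insertion_cup_mult_cochain:
  assumes f: "multilinear scale f" and g: "multilinear scale g"
  shows "insertion (cup f g) mult_cochain xs =
    cup (insertion f mult_cochain) g xs - cup (shift_sign f) (insertion g mult_cochain) xs"
proof -
  define c :: "'a list \<Rightarrow> 'a list \<Rightarrow> 'a" where "c v u = (-1) ^ ((length v + 1) * length u)" for v u
  define F1 where "F1 = (\<lambda>u v b e. c b (u @ v) * (f u * g (v @ mult_cochain b # e)))"
  define F2 where "F2 = (\<lambda>a b u v. c b a * (f (a @ mult_cochain b # u) * g v))"
  have "insertion (cup f g) mult_cochain xs =
    split_sum3 (\<lambda>a b e. split_sum (\<lambda>u v. F1 u v b e) a + split_sum (\<lambda>u v. F2 a b u v) e) xs"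
    unfolding insertion_def c_def[symmetric] cup_eq_split_sum split_sum_append_Cons
      distrib_left split_sum_mult_left[symmetric]
    by (rule split_sum3_cong)
      (intro arg_cong2[of _ _ _ _ "(+)"] split_sum_cong, auto simp: F1_def F2_def)
  also have "\<dots> = split_sum3 (\<lambda>a b e. split_sum (\<lambda>u v. F1 u v b e) a) xs
    + split_sum3 (\<lambda>a b e. split_sum (\<lambda>u v. F2 a b u v) e) xs"
    by (simp add: split_sum3_add)
  also have "split_sum3 (\<lambda>a b e. split_sum (\<lambda>u v. F2 a b u v) e) xs =
    cup (insertion f mult_cochain) g xs"
  proof -
    have "cup (insertion f mult_cochain) g xs =
      split_sum (\<lambda>l v. split_sum (\<lambda>a r. split_sum (\<lambda>b u. F2 a b u v) r) l) xs"
      unfolding cup_eq_split_sum insertion_def split_sum3_def F2_def c_def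
        split_sum_mult_right[symmetric] mult.assoc ..
    also have "\<dots> = split_sum (\<lambda>a s. split_sum (\<lambda>b e. split_sum (\<lambda>u v. F2 a b u v) e) s) xs"
      unfolding split_sum_assoc[of "\<lambda>a r v. split_sum (\<lambda>b u. F2 a b u v) r", symmetric]
        split_sum_assoc[of "\<lambda>b u v. F2 _ b u v", symmetric] ..
    finally show ?thesis
      by (simp only: split_sum3_def)
  qed
  also have "split_sum3 (\<lambda>a b e. split_sum (\<lambda>u v. F1 u v b e) a) xs =
    - cup (shift_sign f) (insertion g mult_cochain) xs"
  proof -
    have "split_sum3 (\<lambda>a b e. split_sum (\<lambda>u v. F1 u v b e) a) xs =
      split_sum (\<lambda>a r. split_sum (\<lambda>u v. split_sum (\<lambda>b e. F1 u v b e) r) a) xs"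
      unfolding split_sum3_def by (rule split_sum_cong) (rule split_sum_swap)
    also have "\<dots> = split_sum (\<lambda>u s. split_sum3 (\<lambda>v b e. F1 u v b e) s) xs"
      unfolding split_sum3_def by (rule split_sum_assoc[symmetric])
    also have "\<dots> = split_sum (\<lambda>u s. (-1) * (shift_sign f u * insertion g mult_cochain s)) xs"
    proof (rule split_sum_cong)
      fix u s
      have "F1 u v b e = (-1) * (shift_sign f u * (c b v * g (v @ mult_cochain b # e)))" for v b e
      proof (cases "length b = 2")
        case True
        then show ?thesis
          by (cases "even (length u)"; cases "even (length v)")
            (simp_all add: F1_def c_def shift_sign_def power_add)
      next
        case False
        then have "mult_cochain b = 0"
          using homogeneous_mult_cochain by (auto simp: homogeneous_def)
        then show ?thesis
          by (simp add: F1_def multilinearD_0[OF g])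
      qed
      then show "split_sum3 (\<lambda>v b e. F1 u v b e) s =
          (-1) * (shift_sign f u * insertion g mult_cochain s)"
        unfolding insertion_def c_def by (simp only: split_sum3_mult_left)
    qed
    also have "\<dots> = - cup (shift_sign f) (insertion g mult_cochain) xs"
      by (simp only: split_sum_mult_left cup_eq_split_sum) simp
    finally show ?thesis .
  qed
  finally show ?thesis
    by simp
qed

lemma coboundary_cup:
  assumes f: "multilinear scale f" and g: "multilinear scale g"
  shows "coboundary (cup f g) xs = cup (coboundary f) g xs - cup (shift_sign f) (coboundary g) xs"
proof -
  define L :: "'a cochain \<Rightarrow> 'a cochain" where
    "L h = (\<lambda>xs. if xs = [] then 0 else hd xs * h (tl xs))" for h
  define R :: "'a cochain \<Rightarrow> 'a cochain" where
    "R h = (\<lambda>xs. if xs = [] then 0 else (-1) ^ length xs * h (butlast xs) * last xs)" for h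
  have d: "coboundary h = (\<lambda>xs. L h xs + R h xs - insertion h mult_cochain xs)"
    if "multilinear scale h" for h
    by (rule ext) (simp add: coboundary_eq_insertion[OF that] insertion_mult_cochain L_def R_def)
  have L: "L (cup f g) xs = cup (L f) g xs"
    by (cases xs) (simp_all add: L_def cup_eq_split_sum mult.assoc split_sum_mult_left)
  have R: "R (cup f g) xs = - cup (shift_sign f) (R g) xs"
  proof (cases xs rule: rev_cases)
    case (snoc ys y)
    have "cup (shift_sign f) (R g) xs =
      split_sum (\<lambda>u v. - ((-1) ^ length xs * (f u * g v * y))) ys"
      unfolding cup_eq_split_sum snoc split_sum_snoc
      by (simp add: R_def) (rule split_sum_cong,
        auto simp: shift_sign_def mult.assoc power_add neg_one_power_left_commute[of "f _"])
    also have "\<dots> = - ((-1) ^ length xs * (split_sum (\<lambda>u v. f u * g v) ys * y))"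
      by (simp only: split_sum_mult_left split_sum_mult_right
          mult_minus_left[of "(-1) ^ length xs", symmetric])
    finally show ?thesis
      by (simp add: R_def cup_eq_split_sum snoc mult.assoc)
  qed (simp add: R_def cup_eq_split_sum)
  have RL: "cup (R f) g xs = cup (shift_sign f) (L g) xs"
  proof -
    have "cup (R f) g xs = split_sum (\<lambda>u v. if u = [] then 0
        else (-1) ^ (length (butlast u) + 1) * f (butlast u) * last u * g v) xs"
      unfolding cup_eq_split_sum by (rule split_sum_cong) (simp add: R_def)
    also have "\<dots> = split_sum (\<lambda>u v. if v = [] then 0
        else (-1) ^ (length u + 1) * f u * hd v * g (tl v)) xs"
      by (rule split_sum_shift)
    also have "\<dots> = cup (shift_sign f) (L g) xs"
      unfolding cup_eq_split_sum
      by (rule split_sum_cong) (simp add: L_def shift_sign_def mult.assoc)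
    finally show ?thesis .
  qed
  show ?thesis
    unfolding d[OF multilinear_cup[OF f g]] d[OF f] d[OF g] L R cup_diff_left cup_diff_right
      cup_add_left cup_add_right RL insertion_cup_mult_cochain[OF f g]
    by simp
qed

end

lemma homogeneous_coboundary: "homogeneous m f \<Longrightarrow> homogeneous (m + 1) (coboundary f)"
proof -
  assume "homogeneous m f"
  then have f: "f ys = 0" if "length ys \<noteq> m" for ys
    using that by (simp add: homogeneous_def)
  have "coboundary f xs = 0" if "length xs \<noteq> m + 1" for xs
  proof (cases xs)
    case (Cons y ys)
    have "f ys = 0"
      using that Cons by (intro f) simp
    moreover have "f (butlast xs) = 0"
      using that Cons by (intro f) auto
    moreover have "f (take i xs @ z # drop (i + 2) xs) = 0" if "i < length xs - 1" for i z
      using that \<open>length xs \<noteq> m + 1\<close> by (intro f) simp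
    ultimately show ?thesis
      using Cons by (simp add: coboundary_def)
  qed (simp add: coboundary_def)
  then show ?thesis
    by (simp add: homogeneous_def)
qed

lemma shift_sign_homogeneous:
  "homogeneous n g \<Longrightarrow> shift_sign g = (\<lambda>xs. (-1) ^ (n + 1) * g xs)"
  by (rule ext) (auto simp: homogeneous_def shift_sign_def)

lemma finite_sum_eq: "finite {(m :: nat, n). m + n = k}"
  by (rule finite_subset[of _ "{..k} \<times> {..k}"]) auto

context algebra_over_field
begin

lemma gerst_circ_homogeneous:
  assumes f: "multilinear scale f" and "homogeneous m f" "homogeneous n g"
  shows "gerst_circ p q f g xs = (if p = m \<and> q = n then insertion f g xs else 0)"
proof -
  have f0: "f ys = 0" if "length ys \<noteq> m" for ys
    using assms(2) that by (simp add: homogeneous_def)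
  have g0: "g ys = 0" if "length ys \<noteq> n" for ys
    using assms(3) that by (simp add: homogeneous_def)
  have ins: "insertion f g xs =
    (\<Sum>i<length xs + 1 - n. (-1) ^ ((length (take n (drop i xs)) + 1) * length (take i xs))
      * f (take i xs @ g (take n (drop i xs)) # drop (i + n) xs))"
    unfolding insertion_def
    by (rule split_sum3_index) (simp add: g0 multilinearD_0[OF f])
  have "insertion f g xs = gerst_circ m n f g xs"
  proof (cases "length xs + 1 = m + n")
    case True
    then have "gerst_circ m n f g xs =
      (\<Sum>i<m. (-1) ^ ((n + 1) * i) * f (take i xs @ g (take n (drop i xs)) # drop (i + n) xs))"
      by (simp only: gerst_circ_def refl if_True)
    also have "\<dots> = insertion f g xs"
      unfolding ins
    proof (rule sum.cong)
      show "{..<m} = {..<length xs + 1 - n}"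
        using True by simp
      fix i
      assume "i \<in> {..<length xs + 1 - n}"
      then have "length (take n (drop i xs)) = n" "length (take i xs) = i"
        by simp_all
      then show "(-1) ^ ((n + 1) * i) * f (take i xs @ g (take n (drop i xs)) # drop (i + n) xs) =
        (-1) ^ ((length (take n (drop i xs)) + 1) * length (take i xs))
          * f (take i xs @ g (take n (drop i xs)) # drop (i + n) xs)"
        by (simp only:)
    qed
    finally show ?thesis ..
  next
    case False
    have "f (take i xs @ z # drop (i + n) xs) = 0" if "i < length xs + 1 - n" for i z
      using False that by (intro f0) simp
    then have "insertion f g xs = 0"
      unfolding ins by (intro sum.neutral) simp
    with False show ?thesis
      by (simp add: gerst_circ_def)
  qed
  moreover have "gerst_circ p q f g xs = 0" if "p \<noteq> m"
  proof -
    have "f (take i xs @ z # drop (i + q) xs) = 0" if "i < p" "length xs + 1 = p + q" for i z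
      using that \<open>p \<noteq> m\<close> by (intro f0) simp
    then show ?thesis
      by (simp add: gerst_circ_def)
  qed
  moreover have "gerst_circ p q f g xs = 0" if "q \<noteq> n"
  proof -
    have "f (take i xs @ g (take q (drop i xs)) # drop (i + q) xs) = 0"
      if "i < p" "length xs + 1 = p + q" for i
    proof -
      have "g (take q (drop i xs)) = 0"
      proof (rule g0)
        have "length (take q (drop i xs)) = q"
          using that by simp
        with \<open>q \<noteq> n\<close> show "length (take q (drop i xs)) \<noteq> n"
          by simp
      qed
      then show ?thesis
        by (simp add: multilinearD_0[OF f])
    qed
    then show ?thesis
      by (simp add: gerst_circ_def)
  qed
  ultimately show ?thesis
    by auto
qed

lemma insertion_homogeneous_0:
  assumes "multilinear scale f" "homogeneous m f" "homogeneous n g" "length xs + 1 \<noteq> m + n"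
  shows "insertion f g xs = 0"
  using gerst_circ_homogeneous[OF assms(1-3), of m n xs] assms(4) by (simp add: gerst_circ_def)

lemma gerst_bracket_homogeneous:
  assumes "multilinear scale f" "homogeneous m f" "multilinear scale g" "homogeneous n g"
  shows "gerst_bracket f g xs =
    insertion f g xs - (-1) ^ ((m + 1) * (n + 1)) * insertion g f xs"
proof -
  let ?r = "insertion f g xs - (-1) ^ ((m + 1) * (n + 1)) * insertion g f xs"
  have "gerst_circ (fst pq) (snd pq) f g xs
      - (-1) ^ ((fst pq + 1) * (snd pq + 1)) * gerst_circ (snd pq) (fst pq) g f xs =
    (if (m, n) = pq then ?r else 0)" for pq
    unfolding gerst_circ_homogeneous[OF assms(1,2,4)] gerst_circ_homogeneous[OF assms(3,4,2)]
    by (cases "pq = (m, n)") (auto simp: prod_eq_iff simp del: power_Suc)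
  then have "gerst_bracket f g xs =
    (\<Sum>pq \<in> {(p, q). p + q = length xs + 1}. if (m, n) = pq then ?r else 0)"
    by (simp only: gerst_bracket_def case_prod_unfold)
  also have "\<dots> = (if m + n = length xs + 1 then ?r else 0)"
    by (subst sum.delta'[OF finite_sum_eq]) (simp only: mem_Collect_eq case_prod_conv)
  also have "\<dots> = ?r"
    using insertion_homogeneous_0[OF assms(1,2,4), of xs] insertion_homogeneous_0[OF assms(3,4,2), of xs]
    by auto
  finally show ?thesis .
qed

lemma gerst_bracket_homogeneous_circ:
  assumes "multilinear scale f" "homogeneous m f" "multilinear scale g" "homogeneous n g"
  shows "gerst_bracket f g xs =
    gerst_circ m n f g xs - (-1) ^ ((m + 1) * (n + 1)) * gerst_circ n m g f xs"
  by (simp add: gerst_bracket_homogeneous[OF assms] gerst_circ_homogeneous[OF assms(1,2,4)]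
      gerst_circ_homogeneous[OF assms(3,4,2)])

lemma gerst_circ_add_left:
  "gerst_circ m n (\<lambda>xs. f xs + f' xs) g xs = gerst_circ m n f g xs + gerst_circ m n f' g xs"
  by (simp add: gerst_circ_def distrib_left sum.distrib del: power_Suc)

lemma gerst_circ_add_right:
  assumes "multilinear scale f"
  shows "gerst_circ m n f (\<lambda>xs. g xs + g' xs) xs = gerst_circ m n f g xs + gerst_circ m n f g' xs"
  by (simp add: gerst_circ_def distrib_left sum.distrib multilinearD_add[OF assms] del: power_Suc)

lemma gerst_bracket_add_left:
  assumes "multilinear scale g"
  shows "gerst_bracket (\<lambda>xs. f xs + f' xs) g xs = gerst_bracket f g xs + gerst_bracket f' g xs"
  by (simp add: gerst_bracket_def gerst_circ_add_left gerst_circ_add_right[OF assms] case_prod_unfold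
      distrib_left add_diff_add sum.distrib del: power_Suc)

lemma gerst_bracket_add_right:
  assumes "multilinear scale f"
  shows "gerst_bracket f (\<lambda>xs. g xs + g' xs) xs = gerst_bracket f g xs + gerst_bracket f g' xs"
  by (simp add: gerst_bracket_def gerst_circ_add_left gerst_circ_add_right[OF assms] case_prod_unfold
      distrib_left add_diff_add sum.distrib del: power_Suc)

lemma cochainsI:
  "multilinear scale f \<Longrightarrow> (\<And>xs. N < length xs \<Longrightarrow> f xs = 0) \<Longrightarrow> f \<in> cochains scale"
  by (auto simp: cochains_def)

lemma cochains_multilinear: "f \<in> cochains scale \<Longrightarrow> multilinear scale f"
  by (simp add: cochains_def)

lemma cochains_homogeneous: "multilinear scale f \<Longrightarrow> homogeneous n f \<Longrightarrow> f \<in> cochains scale"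
  by (rule cochainsI[of f n]) (auto simp: homogeneous_def)

lemma cochains_0: "(\<lambda>xs. 0) \<in> cochains scale"
  by (simp add: cochains_def multilinear_def)

lemma cochains_add:
  assumes "f \<in> cochains scale" "g \<in> cochains scale"
  shows "(\<lambda>xs. f xs + g xs) \<in> cochains scale"
proof -
  obtain M N where "\<forall>xs. M < length xs \<longrightarrow> f xs = 0" "\<forall>xs. N < length xs \<longrightarrow> g xs = 0"
    using assms by (auto simp: cochains_def)
  then show ?thesis
    by (intro cochainsI[of _ "max M N"] multilinear_add assms[THEN cochains_multilinear]) simp_all
qed

lemma cochains_scale: "f \<in> cochains scale \<Longrightarrow> (\<lambda>xs. scale s (f xs)) \<in> cochains scale"
  by (auto simp: cochains_def multilinear_scale)

lemma cochains_minus: "f \<in> cochains scale \<Longrightarrow> (\<lambda>xs. - f xs) \<in> cochains scale"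
  by (auto simp: cochains_def multilinear_minus)

lemma cochains_diff:
  "f \<in> cochains scale \<Longrightarrow> g \<in> cochains scale \<Longrightarrow> (\<lambda>xs. f xs - g xs) \<in> cochains scale"
  using cochains_add[OF _ cochains_minus, of f g] by simp

lemma cochains_shift_sign: "f \<in> cochains scale \<Longrightarrow> shift_sign f \<in> cochains scale"
proof -
  assume f: "f \<in> cochains scale"
  then obtain N where "\<forall>xs. N < length xs \<longrightarrow> f xs = 0"
    by (auto simp: cochains_def)
  then show ?thesis
    by (intro cochainsI[of _ N] multilinear_shift_sign cochains_multilinear[OF f])
      (simp add: shift_sign_def)
qed

lemma cochains_coboundary:
  assumes "f \<in> cochains scale"
  shows "coboundary f \<in> cochains scale"
proof -
  obtain N where "multilinear scale f" "\<forall>xs. N < length xs \<longrightarrow> f xs = 0"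
    using assms by (auto simp: cochains_def)
  then show ?thesis
    by (intro cochainsI[of _ "N + 1"] multilinear_coboundary) (simp_all add: coboundary_def)
qed

lemma cochains_cup:
  assumes "f \<in> cochains scale" "g \<in> cochains scale"
  shows "cup f g \<in> cochains scale"
proof -
  obtain M N where M: "\<forall>xs. M < length xs \<longrightarrow> f xs = 0" and N: "\<forall>xs. N < length xs \<longrightarrow> g xs = 0"
    using assms by (auto simp: cochains_def)
  show ?thesis
  proof (rule cochainsI[of _ "M + N"])
    fix xs :: "'a list"
    assume "M + N < length xs"
    then have "f (take i xs) * g (drop i xs) = 0" if "i \<le> length xs" for i
      using that M[rule_format, of "take i xs"] N[rule_format, of "drop i xs"] by (cases "M < i") auto
    then show "cup f g xs = 0"
      by (simp add: cup_def)
  qed (intro multilinear_cup assms[THEN cochains_multilinear])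
qed

lemma cochains_induct [consumes 1, case_names homogeneous add]:
  assumes f: "f \<in> cochains scale"
    and hom: "\<And>n f. multilinear scale f \<Longrightarrow> homogeneous n f \<Longrightarrow> P f"
    and add: "\<And>f g. f \<in> cochains scale \<Longrightarrow> g \<in> cochains scale \<Longrightarrow> P f \<Longrightarrow> P g \<Longrightarrow>
      P (\<lambda>xs. f xs + g xs)"
  shows "P f"
proof -
  have trunc: "P (\<lambda>xs. if length xs < N then f xs else 0) \<and>
    (\<lambda>xs. if length xs < N then f xs else 0) \<in> cochains scale" for N
  proof (induction N)
    case 0
    show ?case
      using hom[of "\<lambda>xs. 0" 0] cochains_0 by (simp add: cochains_multilinear homogeneous_def)
  next
    case (Suc N)
    have ml: "multilinear scale (component N f)"
      using f by (simp add: multilinear_component cochains_multilinear)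
    have hm: "homogeneous N (component N f)"
      by (rule homogeneous_component)
    have eq: "(\<lambda>xs. if length xs < Suc N then f xs else 0) =
      (\<lambda>xs. (if length xs < N then f xs else 0) + component N f xs)"
      by (auto simp: component_def)
    show ?case
      unfolding eq
      using add[OF _ cochains_homogeneous[OF ml hm] _ hom[OF ml hm]] Suc
        cochains_add[OF _ cochains_homogeneous[OF ml hm]]
      by simp
  qed
  obtain N where "\<forall>xs. N < length xs \<longrightarrow> f xs = 0"
    using f by (auto simp: cochains_def)
  then have "(\<lambda>xs. if length xs < Suc N then f xs else 0) = f"
    by (auto simp: not_less_eq)
  with trunc[of "Suc N"] show ?thesis
    by simp
qed

lemma cochains_gerst_bracket:
  assumes "f \<in> cochains scale" "g \<in> cochains scale"
  shows "gerst_bracket f g \<in> cochains scale"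
  using assms
proof (induction f rule: cochains_induct)
  case (homogeneous m f)
  note f = this(1,2)
  from homogeneous(3) show ?case
  proof (induction g rule: cochains_induct)
    case (homogeneous n g)
    have eq: "gerst_bracket f g =
      (\<lambda>xs. insertion f g xs - (-1) ^ ((m + 1) * (n + 1)) * insertion g f xs)"
      by (rule ext) (rule gerst_bracket_homogeneous[OF f homogeneous])
    have "multilinear scale (\<lambda>xs. (-1) ^ ((m + 1) * (n + 1)) * insertion g f xs)"
      using multilinear_insertion[OF homogeneous(1) f(1)] multilinear_minus
      by (cases "even ((m + 1) * (n + 1))") simp_all
    then have "multilinear scale (gerst_bracket f g)"
      unfolding eq by (intro multilinear_diff multilinear_insertion f homogeneous)
    then show ?case
      by (rule cochainsI[of _ "m + n"])
        (simp add: eq insertion_homogeneous_0[OF f homogeneous(2)]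
          insertion_homogeneous_0[OF homogeneous f(2)])
  next
    case (add g g')
    have "gerst_bracket f (\<lambda>xs. g xs + g' xs) = (\<lambda>xs. gerst_bracket f g xs + gerst_bracket f g' xs)"
      by (rule ext) (rule gerst_bracket_add_right[OF f(1)])
    with add show ?case by (simp add: cochains_add)
  qed
next
  case (add f f')
  have "gerst_bracket (\<lambda>xs. f xs + f' xs) g = (\<lambda>xs. gerst_bracket f g xs + gerst_bracket f' g xs)"
    by (rule ext) (rule gerst_bracket_add_left[OF cochains_multilinear[OF add.prems]])
  with add show ?case by (simp add: cochains_add)
qed

lemma coboundary_gerst_bracket_homogeneous:
  assumes f: "multilinear scale f" "homogeneous m f" and g: "multilinear scale g" "homogeneous n g"
  shows "coboundary (gerst_bracket f g) xs =
    gerst_bracket (coboundary f) (shift_sign g) xs + gerst_bracket f (coboundary g) xs"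
proof -
  note \<mu> = multilinear_mult_cochain homogeneous_mult_cochain
  define s where "s = (-1 :: 'a) ^ ((m + 1) * (n + 1))"
  have br: "gerst_bracket f g = (\<lambda>xs. insertion f g xs - s * insertion g f xs)"
    unfolding s_def by (rule ext) (rule gerst_bracket_homogeneous[OF f g])
  have d: "coboundary h = (\<lambda>xs. (-1) ^ (k + 1) * insertion mult_cochain h xs - insertion h mult_cochain xs)"
    if "multilinear scale h" "homogeneous k h" for h k
    by (rule ext) (simp only: coboundary_eq_insertion[OF that(1)] shift_sign_homogeneous[OF that(2)]
        insertion_sign_right[OF \<mu>(1)])
  have ml_br: "multilinear scale (gerst_bracket f g)"
    by (rule cochains_multilinear[OF cochains_gerst_bracket[OF cochains_homogeneous[OF f]
        cochains_homogeneous[OF g]]])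
  have sh_br: "shift_sign (gerst_bracket f g) = (\<lambda>xs. (-1) ^ (m + n) * gerst_bracket f g xs)"
  proof
    fix xs
    show "shift_sign (gerst_bracket f g) xs = (-1) ^ (m + n) * gerst_bracket f g xs"
    proof (cases "length xs + 1 = m + n")
      case True
      then show ?thesis by (simp only: shift_sign_def)
    next
      case False
      then show ?thesis
        by (simp add: shift_sign_def br insertion_homogeneous_0[OF f g(2)]
          insertion_homogeneous_0[OF g f(2)])
    qed
  qed
  have lhs: "coboundary (gerst_bracket f g) xs = (-1) ^ (m + n) *
      (insertion mult_cochain (insertion f g) xs - s * insertion mult_cochain (insertion g f) xs)
    - (insertion (insertion f g) mult_cochain xs - s * insertion (insertion g f) mult_cochain xs)"
    unfolding coboundary_eq_insertion[OF ml_br] sh_br insertion_sign_right[OF \<mu>(1)]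
    unfolding br s_def insertion_diff_left insertion_sign_left insertion_diff_right[OF \<mu>(1)]
      insertion_sign_right[OF \<mu>(1)] ..
  have sg: "multilinear scale (shift_sign g)" "homogeneous n (shift_sign g)"
    using g by (auto simp: multilinear_shift_sign homogeneous_def shift_sign_def)
  have df: "multilinear scale (coboundary f)" "homogeneous (m + 1) (coboundary f)"
    and dg: "multilinear scale (coboundary g)" "homogeneous (n + 1) (coboundary g)"
    using f g by (simp_all only: multilinear_coboundary homogeneous_coboundary)
  have rhs1: "gerst_bracket (coboundary f) (shift_sign g) xs = (-1) ^ (n + 1) *
      ((-1) ^ (m + 1) * insertion (insertion mult_cochain f) g xs - insertion (insertion f mult_cochain) g xs
      - (-1) ^ ((m + 1 + 1) * (n + 1)) * ((-1) ^ (m + 1) * insertion g (insertion mult_cochain f) xs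
        - insertion g (insertion f mult_cochain) xs))"
    unfolding gerst_bracket_homogeneous[OF df sg]
    unfolding shift_sign_homogeneous[OF g(2)] insertion_sign_left insertion_sign_right[OF df(1)]
    unfolding d[OF f] insertion_diff_left insertion_diff_right[OF g(1)] insertion_sign_left
      insertion_sign_right[OF g(1)]
    by (cases "even m"; cases "even n") simp_all
  have rhs2: "gerst_bracket f (coboundary g) xs =
      (-1) ^ (n + 1) * insertion f (insertion mult_cochain g) xs - insertion f (insertion g mult_cochain) xs
      - (-1) ^ ((m + 1) * (n + 1 + 1)) * ((-1) ^ (n + 1) * insertion (insertion mult_cochain g) f xs
        - insertion (insertion g mult_cochain) f xs)"
    unfolding gerst_bracket_homogeneous[OF f dg]
    unfolding d[OF g] insertion_diff_left insertion_diff_right[OF f(1)] insertion_sign_left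
      insertion_sign_right[OF f(1)] ..
  have move: "a = b + c" if "a - b = c" for a b c :: 'a
    using that by (simp add: diff_eq_eq add.commute)
  have P1: "insertion (insertion mult_cochain f) g xs = insertion mult_cochain (insertion f g) xs
      + s * (insertion (insertion mult_cochain g) f xs - insertion mult_cochain (insertion g f) xs)"
    unfolding s_def by (rule move[OF insertion_pre_Lie[OF \<mu>(1) f(2) g(2)]])
  have P2: "insertion (insertion f mult_cochain) g xs = insertion f (insertion mult_cochain g) xs
      + (-1) ^ ((2 + 1) * (n + 1)) *
        (insertion (insertion f g) mult_cochain xs - insertion f (insertion g mult_cochain) xs)"
    by (rule move[OF insertion_pre_Lie[OF f(1) \<mu>(2) g(2)]])
  have P3: "insertion (insertion g mult_cochain) f xs = insertion g (insertion mult_cochain f) xs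
      + (-1) ^ ((2 + 1) * (m + 1)) *
        (insertion (insertion g f) mult_cochain xs - insertion g (insertion f mult_cochain) xs)"
    by (rule move[OF insertion_pre_Lie[OF g(1) \<mu>(2) f(2)]])
  show ?thesis
    unfolding lhs rhs1 rhs2 P1 P2 P3 s_def
    by (cases "even m"; cases "even n") simp_all
qed

lemma coboundary_gerst_bracket:
  assumes "f \<in> cochains scale" "g \<in> cochains scale"
  shows "coboundary (gerst_bracket f g) xs =
    gerst_bracket (coboundary f) (shift_sign g) xs + gerst_bracket f (coboundary g) xs"
  using assms
proof (induction f arbitrary: xs rule: cochains_induct)
  case (homogeneous m f)
  note f = this(1,2)
  from homogeneous(3) show ?case
  proof (induction g arbitrary: xs rule: cochains_induct)
    case (homogeneous n g)
    show ?case
      by (rule coboundary_gerst_bracket_homogeneous[OF f homogeneous])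
  next
    case (add g g')
    have 1: "gerst_bracket f (\<lambda>xs. g xs + g' xs) = (\<lambda>xs. gerst_bracket f g xs + gerst_bracket f g' xs)"
      by (rule ext) (rule gerst_bracket_add_right[OF f(1)])
    have 2: "shift_sign (\<lambda>xs. g xs + g' xs) = (\<lambda>xs. shift_sign g xs + shift_sign g' xs)"
      by (rule ext) (simp add: shift_sign_def distrib_left del: power_Suc)
    have 3: "coboundary (\<lambda>xs. g xs + g' xs) = (\<lambda>xs. coboundary g xs + coboundary g' xs)"
      by (rule ext) (rule coboundary_add)
    show ?case
      unfolding 1 2 3 coboundary_add gerst_bracket_add_right[OF f(1)]
        gerst_bracket_add_right[OF multilinear_coboundary[OF f(1)]] add.IH
      by simp
  qed
next
  case (add f f')
  note g = cochains_multilinear[OF add.prems]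
  have 1: "gerst_bracket (\<lambda>xs. f xs + f' xs) g = (\<lambda>xs. gerst_bracket f g xs + gerst_bracket f' g xs)"
    by (rule ext) (rule gerst_bracket_add_left[OF g])
  have 3: "coboundary (\<lambda>xs. f xs + f' xs) = (\<lambda>xs. coboundary f xs + coboundary f' xs)"
    by (rule ext) (rule coboundary_add)
  show ?case
    unfolding 1 3 coboundary_add gerst_bracket_add_left[OF multilinear_shift_sign[OF g]]
      gerst_bracket_add_left[OF multilinear_coboundary[OF g]] gerst_bracket_add_left[OF g]
      add.IH[OF add.prems]
    by simp
qed


lemma insertion_mult_cochain_mult_cochain: "insertion mult_cochain mult_cochain = (\<lambda>xs :: 'a list. 0)"
proof
  fix xs :: "'a list"
  note \<mu> = multilinear_mult_cochain homogeneous_mult_cochain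
  show "insertion mult_cochain mult_cochain xs = 0"
  proof (cases "length xs = 3")
    case True
    then obtain x y z where "xs = [x, y, z]"
      by (auto simp: numeral_3_eq_3 length_Suc_conv)
    then show ?thesis
      by (simp add: insertion_def split_sum3_def mult_cochain_def mult.assoc)
  next
    case False
    then show ?thesis
      by (intro insertion_homogeneous_0[OF \<mu> \<mu>(2)]) simp
  qed
qed

lemma coboundary_coboundary_homogeneous:
  assumes f: "multilinear scale f" "homogeneous m f"
  shows "coboundary (coboundary f) xs = 0"
proof -
  note \<mu> = multilinear_mult_cochain homogeneous_mult_cochain
  have d: "coboundary h =
      (\<lambda>xs. (-1) ^ (k + 1) * insertion mult_cochain h xs - insertion h mult_cochain xs)"
    if "multilinear scale h" "homogeneous k h" for h k
    by (rule ext) (simp only: coboundary_eq_insertion[OF that(1)] shift_sign_homogeneous[OF that(2)]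
        insertion_sign_right[OF \<mu>(1)])
  note df = multilinear_coboundary[OF f(1)] homogeneous_coboundary[OF f(2)]
  have zero: "insertion h (\<lambda>xs. 0) xs = 0" if "multilinear scale h" for h xs
    using insertion_diff_right[OF that, of f f xs] by simp
  have zero': "insertion (\<lambda>xs. 0) h xs = 0" for h :: "'a cochain" and xs
    using insertion_diff_left[of f f h xs] by simp
  have 1: "insertion (insertion f mult_cochain) mult_cochain xs = 0"
    using insertion_insertion[OF f(1) \<mu>(2) \<mu>(2), of xs]
    by (simp add: insertion_mult_cochain_mult_cochain zero[OF f(1)])
  have 2: "insertion (insertion mult_cochain f) mult_cochain xs =
      insertion mult_cochain (insertion f mult_cochain) xs
      - (-1) ^ (m + 1) * insertion mult_cochain (insertion mult_cochain f) xs"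
    using insertion_pre_Lie[OF \<mu>(1) f(2) \<mu>(2), of xs]
    by (cases "even m")
      (simp_all add: insertion_mult_cochain_mult_cochain zero' diff_eq_eq add.commute)
  show ?thesis
    unfolding d[OF df] unfolding d[OF f] insertion_diff_left insertion_sign_left
      insertion_diff_right[OF \<mu>(1)] insertion_sign_right[OF \<mu>(1)] 1 2
    by (cases "even m") simp_all
qed

lemma coboundary_coboundary:
  assumes "f \<in> cochains scale"
  shows "coboundary (coboundary f) = (\<lambda>xs. 0)"
  using assms
proof (induction rule: cochains_induct)
  case (homogeneous n f)
  then show ?case
    using coboundary_coboundary_homogeneous by auto
next
  case (add f g)
  have eq: "coboundary (\<lambda>xs. h xs + k xs) = (\<lambda>xs. coboundary h xs + coboundary k xs)"
    for h k :: "'a cochain"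
    by (rule ext) (rule coboundary_add)
  show ?case
    unfolding eq add by simp
qed


subsection \<open>Cocycles and coboundaries\<close>

lemma cocyclesI: "f \<in> cochains scale \<Longrightarrow> (\<And>xs. coboundary f xs = 0) \<Longrightarrow> f \<in> cocycles scale"
  by (auto simp: cocycles_def)

lemma cocycles_cochains: "f \<in> cocycles scale \<Longrightarrow> f \<in> cochains scale"
  by (simp add: cocycles_def)

lemma coboundary_cocycle: "f \<in> cocycles scale \<Longrightarrow> coboundary f = (\<lambda>xs. 0)"
  by (simp add: cocycles_def)

lemma coboundariesI:
  "h \<in> cochains scale \<Longrightarrow> (\<And>xs. f xs = coboundary h xs) \<Longrightarrow> f \<in> coboundaries scale"
  unfolding coboundaries_def by (rule image_eqI[of _ _ h]) auto

lemma coboundariesE: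
  assumes "f \<in> coboundaries scale"
  obtains h where "h \<in> cochains scale" "f = coboundary h"
  using assms by (auto simp: coboundaries_def)

lemma coboundaries_subset_cocycles: "coboundaries scale \<subseteq> cocycles scale"
  by (auto simp: coboundaries_def cocycles_def cochains_coboundary coboundary_coboundary)

lemma cocycles_0: "(\<lambda>xs. 0) \<in> cocycles scale"
  by (simp add: cocycles_def cochains_0 coboundary_0)

lemma cocycles_add:
  "f \<in> cocycles scale \<Longrightarrow> g \<in> cocycles scale \<Longrightarrow> (\<lambda>xs. f xs + g xs) \<in> cocycles scale"
  by (intro cocyclesI) (simp_all add: cocycles_cochains cochains_add coboundary_add coboundary_cocycle)

lemma cocycles_diff:
  "f \<in> cocycles scale \<Longrightarrow> g \<in> cocycles scale \<Longrightarrow> (\<lambda>xs. f xs - g xs) \<in> cocycles scale"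
  by (intro cocyclesI) (simp_all add: cocycles_cochains cochains_diff coboundary_diff coboundary_cocycle)

lemma cocycles_minus: "f \<in> cocycles scale \<Longrightarrow> (\<lambda>xs. - f xs) \<in> cocycles scale"
  using cocycles_diff[OF cocycles_0, of f] by simp

lemma cocycles_scale: "f \<in> cocycles scale \<Longrightarrow> (\<lambda>xs. scale s (f xs)) \<in> cocycles scale"
  by (intro cocyclesI) (simp_all add: cocycles_cochains cochains_scale coboundary_scale coboundary_cocycle)

lemma cocycles_shift_sign: "f \<in> cocycles scale \<Longrightarrow> shift_sign f \<in> cocycles scale"
  by (intro cocyclesI)
    (simp_all add: cocycles_cochains cochains_shift_sign coboundary_shift_sign coboundary_cocycle,
      simp add: shift_sign_def)

lemma cocycles_cup:
  assumes "f \<in> cocycles scale" "g \<in> cocycles scale"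
  shows "cup f g \<in> cocycles scale"
proof (rule cocyclesI)
  show "coboundary (cup f g) xs = 0" for xs
    using assms coboundary_cup[of f g xs]
    by (simp add: cocycles_cochains cochains_multilinear coboundary_cocycle) (simp add: cup_def)
qed (use assms in \<open>simp add: cocycles_cochains cochains_cup\<close>)

lemma gerst_bracket_0_left: "multilinear scale g \<Longrightarrow> gerst_bracket (\<lambda>xs. 0) g xs = 0"
  using gerst_bracket_add_left[of g "\<lambda>xs. 0" "\<lambda>xs. 0" xs] by simp

lemma gerst_bracket_0_right: "multilinear scale f \<Longrightarrow> gerst_bracket f (\<lambda>xs. 0) xs = 0"
  using gerst_bracket_add_right[of f "\<lambda>xs. 0" "\<lambda>xs. 0" xs] by simp

lemma cocycles_gerst_bracket:
  assumes "f \<in> cocycles scale" "g \<in> cocycles scale"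
  shows "gerst_bracket f g \<in> cocycles scale"
proof (rule cocyclesI)
  show "coboundary (gerst_bracket f g) xs = 0" for xs
    using assms coboundary_gerst_bracket[of f g xs]
    by (simp add: cocycles_cochains cochains_multilinear coboundary_cocycle gerst_bracket_0_left
        gerst_bracket_0_right multilinear_shift_sign)
qed (use assms in \<open>simp add: cocycles_cochains cochains_gerst_bracket\<close>)

lemma coboundaries_0: "(\<lambda>xs. 0) \<in> coboundaries scale"
  by (rule coboundariesI[OF cochains_0]) (simp add: coboundary_0)

lemma coboundaries_add:
  assumes "f \<in> coboundaries scale" "g \<in> coboundaries scale"
  shows "(\<lambda>xs. f xs + g xs) \<in> coboundaries scale"
proof -
  obtain h k where "h \<in> cochains scale" "f = coboundary h" "k \<in> cochains scale" "g = coboundary k"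
    using assms by (elim coboundariesE)
  then show ?thesis
    by (intro coboundariesI[of "\<lambda>xs. h xs + k xs"] cochains_add) (simp_all add: coboundary_add)
qed

lemma coboundaries_scale:
  assumes "f \<in> coboundaries scale"
  shows "(\<lambda>xs. scale s (f xs)) \<in> coboundaries scale"
proof -
  obtain h where "h \<in> cochains scale" "f = coboundary h"
    using assms by (elim coboundariesE)
  then show ?thesis
    by (intro coboundariesI[of "\<lambda>xs. scale s (h xs)"] cochains_scale) (simp_all add: coboundary_scale)
qed

lemma coboundaries_minus:
  assumes "f \<in> coboundaries scale"
  shows "(\<lambda>xs. - f xs) \<in> coboundaries scale"
  using coboundaries_scale[OF assms, of "- 1"] by simp

lemma cup_coboundary_left:
  assumes "f \<in> coboundaries scale" "g \<in> cocycles scale"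
  shows "cup f g \<in> coboundaries scale"
proof -
  obtain h where h: "h \<in> cochains scale" "f = coboundary h"
    using assms(1) by (elim coboundariesE)
  have "coboundary (cup h g) xs = cup f g xs" for xs
    using coboundary_cup[of h g xs] assms(2) h
    by (simp add: cocycles_cochains cochains_multilinear coboundary_cocycle) (simp add: cup_def)
  then show ?thesis
    using assms(2) h by (intro coboundariesI[of "cup h g"] cochains_cup) (simp_all add: cocycles_cochains)
qed

lemma cup_coboundary_right:
  assumes "f \<in> cocycles scale" "g \<in> coboundaries scale"
  shows "cup f g \<in> coboundaries scale"
proof -
  obtain h where h: "h \<in> cochains scale" "g = coboundary h"
    using assms(2) by (elim coboundariesE)
  have "coboundary (cup (shift_sign f) h) xs = - cup f g xs" for xs
    using coboundary_cup[of "shift_sign f" h xs] assms(1) h cocycles_shift_sign[OF assms(1)]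
    by (simp add: cocycles_cochains cochains_multilinear coboundary_cocycle shift_sign_shift_sign)
      (simp add: cup_def)
  then have "(\<lambda>xs. - cup f g xs) \<in> coboundaries scale"
    using assms(1) h
    by (intro coboundariesI[of "cup (shift_sign f) h"] cochains_cup)
      (simp_all add: cocycles_cochains cochains_shift_sign)
  then show ?thesis
    using coboundaries_minus by fastforce
qed

lemma gerst_bracket_coboundary_right:
  assumes "f \<in> cocycles scale" "g \<in> coboundaries scale"
  shows "gerst_bracket f g \<in> coboundaries scale"
proof -
  obtain h where h: "h \<in> cochains scale" "g = coboundary h"
    using assms(2) by (elim coboundariesE)
  have "coboundary (gerst_bracket f h) xs = gerst_bracket f g xs" for xs
    using coboundary_gerst_bracket[of f h xs] assms(1) h
    by (simp add: cocycles_cochains cochains_multilinear coboundary_cocycle gerst_bracket_0_left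
        multilinear_shift_sign)
  then show ?thesis
    using assms(1) h
    by (intro coboundariesI[of "gerst_bracket f h"] cochains_gerst_bracket)
      (simp_all add: cocycles_cochains)
qed

lemma gerst_bracket_coboundary_left:
  assumes "f \<in> coboundaries scale" "g \<in> cocycles scale"
  shows "gerst_bracket f g \<in> coboundaries scale"
proof -
  obtain h where h: "h \<in> cochains scale" "f = coboundary h"
    using assms(1) by (elim coboundariesE)
  have "coboundary (gerst_bracket h (shift_sign g)) xs = gerst_bracket f g xs" for xs
    using coboundary_gerst_bracket[of h "shift_sign g" xs] h assms(2) cocycles_shift_sign[OF assms(2)]
    by (simp add: cocycles_cochains cochains_multilinear coboundary_cocycle gerst_bracket_0_right
        shift_sign_shift_sign)
  then show ?thesis
    using assms(2) h
    by (intro coboundariesI[of "gerst_bracket h (shift_sign g)"] cochains_gerst_bracket)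
      (simp_all add: cocycles_cochains cochains_shift_sign)
qed

end


section \<open>Hochschild cohomology of the Fomin--Kirillov algebra\<close>

definition cohomologous :: "'k::field fk3 cochain \<Rightarrow> 'k fk3 cochain \<Rightarrow> bool"
  where "cohomologous f g \<longleftrightarrow> f \<in> cocycles fk3_scale \<and> g \<in> cocycles fk3_scale
    \<and> (\<lambda>xs. f xs - g xs) \<in> coboundaries fk3_scale"

lemma cohomologous_refl: "f \<in> cocycles fk3_scale \<Longrightarrow> cohomologous f f"
  by (simp add: cohomologous_def fk3.coboundaries_0)

lemma part_equivp_cohomologous: "part_equivp (cohomologous :: 'k::field fk3 cochain \<Rightarrow> _)"
proof (rule part_equivpI)
  show "\<exists>f :: 'k fk3 cochain. cohomologous f f"
    using cohomologous_refl fk3.cocycles_0 by blast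
  show "symp (cohomologous :: 'k fk3 cochain \<Rightarrow> _)"
  proof (rule sympI)
    fix f g :: "'k fk3 cochain"
    assume "cohomologous f g"
    then show "cohomologous g f"
      using fk3.coboundaries_minus[of "\<lambda>xs. f xs - g xs"] by (simp add: cohomologous_def)
  qed
  show "transp (cohomologous :: 'k fk3 cochain \<Rightarrow> _)"
  proof (rule transpI)
    fix f g h :: "'k fk3 cochain"
    assume "cohomologous f g" "cohomologous g h"
    then show "cohomologous f h"
      using fk3.coboundaries_add[of "\<lambda>xs. f xs - g xs" "\<lambda>xs. g xs - h xs"]
      by (simp add: cohomologous_def)
  qed
qed

text \<open>\<open>'k hh\<close> is the total space \<open>HH\<^sup>\<bullet>(A) = \<Oplus>\<^sub>n HH\<^sup>n(A)\<close> for \<open>A = FK(3)\<close> over \<open>'k\<close>.\<close>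

quotient_type (overloaded) 'k hh = "'k::field fk3 cochain" / partial: cohomologous
  by (rule part_equivp_cohomologous)

instantiation hh :: (field) ring_1
begin

lift_definition zero_hh :: "'a hh" is "\<lambda>xs. 0"
  by (rule cohomologous_refl) (rule fk3.cocycles_0)

lift_definition one_hh :: "'a hh" is "\<lambda>xs. if xs = [] then 1 else 0"
proof (rule cohomologous_refl, rule fk3.cocyclesI)
  let ?u = "\<lambda>xs :: 'a fk3 list. if xs = [] then 1 else 0 :: 'a fk3"
  show "?u \<in> cochains fk3_scale"
    by (rule fk3.cochainsI[of _ 0]) (auto simp: multilinear_def)
  show "coboundary ?u xs = 0" for xs
    by (cases xs rule: remdups_adj.cases) (simp_all add: coboundary_def)
qed

lift_definition plus_hh :: "'a hh \<Rightarrow> 'a hh \<Rightarrow> 'a hh" is "\<lambda>f g xs. f xs + g xs"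
  using fk3.coboundaries_add by (fastforce simp: cohomologous_def fk3.cocycles_add add_diff_add)

lift_definition uminus_hh :: "'a hh \<Rightarrow> 'a hh" is "\<lambda>f xs. - f xs"
  using fk3.coboundaries_minus by (fastforce simp: cohomologous_def fk3.cocycles_minus)

lift_definition minus_hh :: "'a hh \<Rightarrow> 'a hh \<Rightarrow> 'a hh" is "\<lambda>f g xs. f xs - g xs"
proof -
  fix f f' g g' :: "'a fk3 cochain"
  assume "cohomologous f f'" "cohomologous g g'"
  then show "cohomologous (\<lambda>xs. f xs - g xs) (\<lambda>xs. f' xs - g' xs)"
    using fk3.coboundaries_add[OF _ fk3.coboundaries_minus, of "\<lambda>xs. f xs - f' xs" "\<lambda>xs. g xs - g' xs"]
    by (simp add: cohomologous_def fk3.cocycles_diff algebra_simps)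
qed

lift_definition times_hh :: "'a hh \<Rightarrow> 'a hh \<Rightarrow> 'a hh" is cup
proof -
  fix f f' g g' :: "'a fk3 cochain"
  assume *: "cohomologous f f'" "cohomologous g g'"
  have "(\<lambda>xs. cup f g xs - cup f' g' xs) =
    (\<lambda>xs. cup (\<lambda>xs. f xs - f' xs) g xs + cup f' (\<lambda>xs. g xs - g' xs) xs)"
    by (simp add: cup_diff_left cup_diff_right)
  with * show "cohomologous (cup f g) (cup f' g')"
    by (simp add: cohomologous_def fk3.cocycles_cup fk3.coboundaries_add fk3.cup_coboundary_left
        fk3.cup_coboundary_right)
qed

instance
proof
  fix x y z :: "'a hh"
  show "x + y + z = x + (y + z)"
    by transfer (auto simp: cohomologous_def fk3.cocycles_add fk3.coboundaries_0 add.assoc)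
  show "x + y = y + x"
    by transfer (auto simp: cohomologous_def fk3.cocycles_add fk3.coboundaries_0 add.commute)
  show "0 + x = x"
    by transfer (auto simp: cohomologous_def)
  show "- x + x = 0"
    by transfer (simp add: cohomologous_refl fk3.cocycles_0)
  show "x - y = x + - y"
    by transfer (auto simp: cohomologous_def fk3.cocycles_diff fk3.coboundaries_0)
  show "x * y * z = x * (y * z)"
    by transfer (auto simp: cohomologous_def fk3.cocycles_cup cup_assoc fk3.coboundaries_0)
  show "(x + y) * z = x * z + y * z"
    by transfer (auto simp: cohomologous_def fk3.cocycles_cup fk3.cocycles_add cup_add_left
        fk3.coboundaries_0)
  show "x * (y + z) = x * y + x * z"
    by transfer (auto simp: cohomologous_def fk3.cocycles_cup fk3.cocycles_add cup_add_right
        fk3.coboundaries_0)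
  have "cup (\<lambda>xs. if xs = [] then 1 else 0) f = f" for f :: "'a fk3 cochain"
    by (rule ext) (simp add: cup_eq_split_sum split_sum_Nil)
  then show "1 * x = x"
    by transfer (auto simp: cohomologous_def)
  have "cup f (\<lambda>xs. if xs = [] then 1 else 0) = f" for f :: "'a fk3 cochain"
    by (rule ext) (simp add: cup_eq_split_sum split_sum_Nil_right)
  then show "x * 1 = x"
    by transfer (auto simp: cohomologous_def)
  show "(0 :: 'a hh) \<noteq> 1"
  proof (transfer, rule notI)
    assume "cohomologous (\<lambda>xs. 0 :: 'a fk3) (\<lambda>xs. if xs = [] then 1 else 0)"
    then have "(\<lambda>xs. 0 - (if xs = [] then 1 else 0 :: 'a fk3)) \<in> coboundaries fk3_scale"
      by (simp only: cohomologous_def)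
    then obtain h :: "'a fk3 cochain" where
      h: "(\<lambda>xs. 0 - (if xs = [] then 1 else 0)) = coboundary h"
      by (rule fk3.coboundariesE)
    from fun_cong[OF h, of "[]"] show False
      by (simp add: coboundary_def)
  qed
qed

end

lift_definition hh_scale :: "'k::field \<Rightarrow> 'k hh \<Rightarrow> 'k hh" is "\<lambda>s f xs. fk3_scale s (f xs)"
proof -
  fix s :: 'k and f g :: "'k fk3 cochain"
  assume "cohomologous f g"
  then show "cohomologous (\<lambda>xs. fk3_scale s (f xs)) (\<lambda>xs. fk3_scale s (g xs))"
    using fk3.coboundaries_scale[of "\<lambda>xs. f xs - g xs" s]
    by (simp add: cohomologous_def fk3.cocycles_scale fk3.scale_right_diff_distrib)
qed

global_interpretation hh: algebra_over_field "hh_scale :: 'k::field \<Rightarrow> 'k hh \<Rightarrow> 'k hh"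
proof
  fix s t :: 'k and x y :: "'k hh"
  show "hh_scale s (x + y) = hh_scale s x + hh_scale s y"
    by transfer (auto simp: cohomologous_def fk3.cocycles_add fk3.cocycles_scale
        fk3.scale_right_distrib fk3.coboundaries_0)
  show "hh_scale (s + t) x = hh_scale s x + hh_scale t x"
    by transfer (auto simp: cohomologous_def fk3.cocycles_add fk3.cocycles_scale
        fk3.scale_left_distrib fk3.coboundaries_0)
  show "hh_scale s (hh_scale t x) = hh_scale (s * t) x"
    by transfer (auto simp: cohomologous_def fk3.cocycles_scale fk3.coboundaries_0)
  show "hh_scale 1 x = x"
    by transfer (auto simp: cohomologous_def)
  have eq: "cup (\<lambda>xs. fk3_scale s (f xs)) g = (\<lambda>xs. fk3_scale s (cup f g xs))"
    "cup f (\<lambda>xs. fk3_scale s (g xs)) = (\<lambda>xs. fk3_scale s (cup f g xs))" for f g s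
    by (rule ext; simp add: cup_def fk3.scale_mult_left fk3.scale_mult_right fk3.scale_sum_right)+
  show "hh_scale s x * y = hh_scale s (x * y)" "x * hh_scale s y = hh_scale s (x * y)"
    by (transfer; auto simp: cohomologous_def eq fk3.cocycles_scale fk3.cocycles_cup
        fk3.coboundaries_0)+
qed

lift_definition hh_bracket :: "'k::field hh \<Rightarrow> 'k hh \<Rightarrow> 'k hh" is gerst_bracket
proof -
  fix f f' g g' :: "'k fk3 cochain"
  assume *: "cohomologous f f'" "cohomologous g g'"
  then have ml: "multilinear fk3_scale g" "multilinear fk3_scale f'"
    by (auto simp: cohomologous_def intro: fk3.cochains_multilinear fk3.cocycles_cochains)
  have "gerst_bracket f g xs = gerst_bracket (\<lambda>xs. f xs - f' xs) g xs + gerst_bracket f' g xs" for xs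
    using fk3.gerst_bracket_add_left[OF ml(1), of "\<lambda>xs. f xs - f' xs" f' xs] by simp
  moreover have "gerst_bracket f' g xs =
    gerst_bracket f' (\<lambda>xs. g xs - g' xs) xs + gerst_bracket f' g' xs" for xs
    using fk3.gerst_bracket_add_right[OF ml(2), of "\<lambda>xs. g xs - g' xs" g' xs] by simp
  ultimately have "(\<lambda>xs. gerst_bracket f g xs - gerst_bracket f' g' xs) =
    (\<lambda>xs. gerst_bracket (\<lambda>xs. f xs - f' xs) g xs + gerst_bracket f' (\<lambda>xs. g xs - g' xs) xs)"
    by simp
  with * show "cohomologous (gerst_bracket f g) (gerst_bracket f' g')"
    by (simp add: cohomologous_def fk3.cocycles_gerst_bracket fk3.coboundaries_add
        fk3.gerst_bracket_coboundary_left fk3.gerst_bracket_coboundary_right)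
qed

text \<open>The summand \<open>HH\<^sup>n(A)\<close>.\<close>

definition hh_degree :: "nat \<Rightarrow> 'k::field hh set"
  where "hh_degree n = {abs_hh f |f. f \<in> cocycles fk3_scale \<and> homogeneous n f}"

text \<open>Degree \<open>-1\<close> includes the vanishing on \<open>HH\<^sup>0(A)\<close>, since \<open>HH\<^sup>-\<^sup>1(A) = 0\<close>.\<close>

definition degree_minus_one :: "('k::field hh \<Rightarrow> 'k hh) \<Rightarrow> bool"
  where "degree_minus_one \<Delta> \<longleftrightarrow>
    (\<forall>x \<in> hh_degree 0. \<Delta> x = 0) \<and> (\<forall>n. \<forall>x \<in> hh_degree (Suc n). \<Delta> x \<in> hh_degree n)"

definition generates_bracket :: "('k::field hh \<Rightarrow> 'k hh) \<Rightarrow> bool"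
  where "generates_bracket \<Delta> \<longleftrightarrow>
    Vector_Spaces.linear hh_scale hh_scale \<Delta> \<and> degree_minus_one \<Delta> \<and>
    (\<forall>m n. \<forall>x \<in> hh_degree m. \<forall>y \<in> hh_degree n.
      hh_bracket x y = (-1) ^ m * (\<Delta> (x * y) - \<Delta> x * y - (-1) ^ m * x * \<Delta> y))"

definition batalin_vilkovisky :: "('k::field hh \<Rightarrow> 'k hh) \<Rightarrow> bool"
  where "batalin_vilkovisky \<Delta> \<longleftrightarrow> generates_bracket \<Delta> \<and> (\<forall>x. \<Delta> (\<Delta> x) = 0)"

end

theory Submission
  imports Defs
begin

text \<open>
  Let \<open>s = abac\<close> span the socle of \<open>A\<close>. Let \<open>E\<close> be the Euler derivation and \<open>D\<close> the derivation with
  \<open>a \<mapsto> bac\<close> and \<open>b, c \<mapsto> 0\<close>. The deformation \<open>a\<^sup>2 = t\<close> of the relation \<open>a\<^sup>2 = 0\<close> suggests a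
  2-cocycle \<open>F\<close>: if \<open>\<sigma>\<close> is the automorphism \<open>a \<mapsto> -a\<close>, \<open>b \<mapsto> -c\<close>, \<open>c \<mapsto> -b\<close>, there are a right and a
  left \<open>\<sigma>\<close>-derivation of internal degree \<open>-1\<close> with \<open>a \<mapsto> 1\<close> and \<open>b, c \<mapsto> 0\<close>, and \<open>F\<close> is their
  product. On the nose one has \<open>sE = 0\<close>, \<open>sF = ED\<close>, \<open>[s,E] = -4s\<close>, \<open>[s,F] = -2D\<close>, \<open>[E,D] = 2D\<close>,
  and \<open>s\<close> annihilates every derivation.

  If \<open>\<Delta>\<close> generates the bracket, then \<open>sE = 0\<close> gives \<open>s\<Delta>(E) = 4s\<close>, and \<open>sF = ED\<close> gives
  \<open>\<Delta>(ED) = -2D\<close>. With this the identity for \<open>[E,D]\<close> becomes \<open>\<Delta>(E)D = E\<Delta>(D)\<close> in \<open>HH\<^sup>1(A)\<close>.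
  Evaluating at \<open>a\<close> and multiplying by \<open>a\<close> from the left yields \<open>4s = -apa\<close> for some \<open>p\<close>, which is
  impossible because \<open>aAa\<close> has no component in degree 4.
\<close>

section \<open>Linear maps out of the Fomin--Kirillov algebra\<close>

abbreviation gen :: "fk3_gen \<Rightarrow> 'k::field fk3" where "gen g \<equiv> abs_fk3 (fk3_var g)"
abbreviation gen_a :: "'k::field fk3" where "gen_a \<equiv> gen Gen_a"
abbreviation gen_b :: "'k::field fk3" where "gen_b \<equiv> gen Gen_b"
abbreviation gen_c :: "'k::field fk3" where "gen_c \<equiv> gen Gen_c"

primrec fk3_mon :: "fk3_gen list \<Rightarrow> 'k::field fk3"
  where
    "fk3_mon [] = 1"
  | "fk3_mon (g # w) = gen g * fk3_mon w"

lemma fk3_mon_append: "fk3_mon (u @ v) = fk3_mon u * fk3_mon v"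
  by (induction u) (simp_all add: mult.assoc)

lemma abs_fk3_monomial: "abs_fk3 (Poly_Mapping.single (Word w) 1) = fk3_mon w"
proof (induction w)
  case Nil
  then show ?case
    by (simp add: one_fk3_def flip: zero_fk3_word_def)
next
  case (Cons g w)
  have "Poly_Mapping.single (Word (g # w)) (1 :: 'a) = fk3_var g * Poly_Mapping.single (Word w) 1"
    by (simp add: fk3_var_def mult_single plus_fk3_word_def)
  with Cons show ?case
    by (simp flip: times_fk3.abs_eq)
qed

lemma update_eq_add_monomial:
  "w \<notin> Poly_Mapping.keys f \<Longrightarrow> Poly_Mapping.update w t f = f + Poly_Mapping.single w (t :: 'k::field)"
  by (intro poly_mapping_eqI)
    (auto simp: lookup_update lookup_add lookup_single when_def in_keys_iff)

lemma fk3_free_induct [case_names zero add]: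
  assumes "P 0"
    and "\<And>p w s. P p \<Longrightarrow> P (p + Poly_Mapping.single (Word w) (s :: 'k::field))"
  shows "P p"
proof (induction p rule: update_induct)
  case (update f w t)
  then show ?case
    using assms(2)[of f "letters w" t] by (simp add: update_eq_add_monomial)
qed (rule assms(1))

text \<open>Images of words span \<open>A\<close>. The zero element is covered by
  \<open>scale\<close> with scalar 0.\<close>

lemma fk3_induct [case_names mon add scale]:
  fixes x :: "'k::field fk3"
  assumes mon: "\<And>w. P (fk3_mon w)"
    and add: "\<And>x y. P x \<Longrightarrow> P y \<Longrightarrow> P (x + y)"
    and scale: "\<And>s x. P x \<Longrightarrow> P (fk3_scale s x)"
  shows "P x"
proof -
  have "P (abs_fk3 p)" for p :: "'k fk3_free"
  proof (induction p rule: fk3_free_induct)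
    case zero
    show ?case
      using scale[OF mon, of 0 "[]"] by (simp add: zero_fk3_def)
  next
    case (add p w s)
    have "Poly_Mapping.single (Word w) s = Poly_Mapping.single 0 s * Poly_Mapping.single (Word w) 1"
      by (simp add: mult_single)
    then have "abs_fk3 (p + Poly_Mapping.single (Word w) s) = abs_fk3 p + fk3_scale s (fk3_mon w)"
      by (simp add: fk3_scale.abs_eq flip: plus_fk3.abs_eq abs_fk3_monomial)
    with add assms(1-3) show ?case
      by simp
  qed
  then show ?thesis
    by (induction x rule: fk3.abs_induct)
qed

text \<open>The contexts \<open>u\<close> and \<open>v\<close> make this the vanishing of the linear
  extension of \<open>f\<close> on the whole two-sided ideal.\<close>

definition respects_relators :: "(fk3_gen list \<Rightarrow> 'k::field fk3) \<Rightarrow> bool"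
  where "respects_relators f \<longleftrightarrow>
    (\<forall>u v. (\<forall>g. f (u @ [g, g] @ v) = 0) \<and>
      f (u @ [Gen_a, Gen_b] @ v) + f (u @ [Gen_b, Gen_c] @ v) + f (u @ [Gen_c, Gen_a] @ v) = 0 \<and>
      f (u @ [Gen_b, Gen_a] @ v) + f (u @ [Gen_a, Gen_c] @ v) + f (u @ [Gen_c, Gen_b] @ v) = 0)"

definition free_lift :: "(fk3_gen list \<Rightarrow> 'k::field fk3) \<Rightarrow> 'k fk3_free \<Rightarrow> 'k fk3"
  where "free_lift f p =
    (\<Sum>w\<in>Poly_Mapping.keys p. fk3_scale (Poly_Mapping.lookup p w) (f (letters w)))"

text \<open>In general the value may depend on the representative chosen by \<open>rep_fk3\<close>;
  under \<open>respects_relators f\<close>, \<open>fk3_lift_abs\<close> removes the choice.\<close>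

definition fk3_lift :: "(fk3_gen list \<Rightarrow> 'k::field fk3) \<Rightarrow> 'k fk3 \<Rightarrow> 'k fk3"
  where "fk3_lift f x = free_lift f (rep_fk3 x)"

lemma free_lift_superset:
  assumes "finite S" "Poly_Mapping.keys p \<subseteq> S"
  shows "free_lift f p = (\<Sum>w\<in>S. fk3_scale (Poly_Mapping.lookup p w) (f (letters w)))"
  unfolding free_lift_def using assms
  by (intro sum.mono_neutral_left) (auto simp: in_keys_iff)

lemma free_lift_add: "free_lift f (p + q) = free_lift f p + free_lift f q"
proof -
  let ?S = "Poly_Mapping.keys p \<union> Poly_Mapping.keys q"
  have "Poly_Mapping.keys (p + q) \<subseteq> ?S"
    by (rule keys_add)
  then show ?thesis
    by (simp add: free_lift_superset[of ?S] lookup_add fk3.scale_left_distrib sum.distrib)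
qed

lemma free_lift_monomial: "free_lift f (Poly_Mapping.single (Word w) s) = fk3_scale s (f w)"
  by (simp add: free_lift_def)

lemma free_lift_0 [simp]: "free_lift f 0 = 0"
  by (simp add: free_lift_def)

lemma free_lift_scale: "free_lift f (Poly_Mapping.single 0 s * p) = fk3_scale s (free_lift f p)"
  by (induction p rule: fk3_free_induct)
    (simp_all add: distrib_left free_lift_add mult_single free_lift_monomial fk3.scale_right_distrib)

lemma free_lift_relator:
  assumes f: "respects_relators f" and r: "r \<in> fk3_relators"
  shows "free_lift f (p * r * q) = 0"
proof (induction p arbitrary: q rule: fk3_free_induct)
  case (add p u s)
  have "free_lift f (Poly_Mapping.single (Word u) s * r * q) = 0"
  proof (induction q rule: fk3_free_induct)
    case (add q v t)
    have "free_lift f (Poly_Mapping.single (Word u) s * r * Poly_Mapping.single (Word v) t) = 0"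
      using r f
      by (auto simp: fk3_relators_def Let_def fk3_var_def distrib_left distrib_right mult_single
          plus_fk3_word_def free_lift_add free_lift_monomial respects_relators_def
          simp flip: fk3.scale_right_distrib)
    with add show ?case
      by (simp add: distrib_left free_lift_add)
  qed simp
  with add show ?case
    by (simp add: distrib_right free_lift_add)
qed simp

text \<open>The outer factors are general so that the \<open>mult\<close> case is absorbed into
  them: \<open>u\<close> joins \<open>p\<close> and \<open>v\<close> joins \<open>q\<close>.\<close>

lemma free_lift_ideal:
  assumes f: "respects_relators f" and "r \<in> fk3_ideal"
  shows "free_lift f (p * r * q) = 0"
  using assms(2)
proof (induction arbitrary: p q)
  case (mult r u v)
  from mult.IH[of "p * u" "v * q"] show ?case
    by (simp add: mult.assoc)
qed (simp_all add: free_lift_relator[OF f] distrib_left distrib_right free_lift_add)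

lemma fk3_lift_abs:
  assumes f: "respects_relators f"
  shows "fk3_lift f (abs_fk3 p) = free_lift f p"
proof -
  have "fk3_rel (rep_fk3 (abs_fk3 p)) p"
    using Quotient3_rep_abs[OF Quotient3_fk3, of p] by (simp add: fk3_rel_refl)
  then have "free_lift f (rep_fk3 (abs_fk3 p) - p) = 0"
    using free_lift_ideal[OF f, of "rep_fk3 (abs_fk3 p) - p" 1 1] by (simp add: fk3_rel_def)
  then show ?thesis
    using free_lift_add[of f "rep_fk3 (abs_fk3 p) - p" p] by (simp add: fk3_lift_def)
qed

abbreviation fk3_linear :: "('k::field fk3 \<Rightarrow> 'k fk3) \<Rightarrow> bool"
  where "fk3_linear \<equiv> Vector_Spaces.linear fk3_scale fk3_scale"

lemma fk3_linearI:
  "(\<And>x y. f (x + y) = f x + f y) \<Longrightarrow> (\<And>s x. f (fk3_scale s x) = fk3_scale s (f x)) \<Longrightarrow> fk3_linear f"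
  by (simp add: Vector_Spaces.linear_iff fk3.vector_space_axioms)

lemma fk3_linear_lift:
  assumes f: "respects_relators f"
  shows "fk3_linear (fk3_lift f)"
proof (rule fk3_linearI)
  fix s and x y :: "'a fk3"
  show "fk3_lift f (x + y) = fk3_lift f x + fk3_lift f y"
    by (induction x rule: fk3.abs_induct, induction y rule: fk3.abs_induct)
      (simp add: plus_fk3.abs_eq fk3_lift_abs[OF f] free_lift_add)
  show "fk3_lift f (fk3_scale s x) = fk3_scale s (fk3_lift f x)"
    by (induction x rule: fk3.abs_induct)
      (simp add: fk3_scale.abs_eq fk3_lift_abs[OF f] free_lift_scale)
qed

lemma fk3_lift_mon:
  assumes f: "respects_relators f"
  shows "fk3_lift f (fk3_mon w) = f w"
  using fk3_lift_abs[OF f, of "Poly_Mapping.single (Word w) 1"]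
  by (simp add: abs_fk3_monomial free_lift_monomial)

section \<open>Arithmetic in the Fomin--Kirillov algebra\<close>

lemma abs_fk3_ideal: "p \<in> fk3_ideal \<Longrightarrow> abs_fk3 p = 0"
  using fk3.abs_eq_iff[of p 0] by (simp add: fk3_rel_def zero_fk3_def)

lemma gen_square: "gen g * gen g = 0"
  unfolding times_fk3.abs_eq
  by (rule abs_fk3_ideal, rule fk3_ideal.relator, cases g) (simp_all add: fk3_relators_def Let_def)

lemma gen_cyclic:
  "gen_a * gen_b + gen_b * gen_c + gen_c * gen_a = 0"
  "gen_b * gen_a + gen_a * gen_c + gen_c * gen_b = 0"
  unfolding times_fk3.abs_eq plus_fk3.abs_eq
  by (rule abs_fk3_ideal, rule fk3_ideal.relator, simp add: fk3_relators_def Let_def)+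

lemma gen_ca: "gen_c * gen_a = - (gen_a * gen_b + gen_b * gen_c)"
  using gen_cyclic(1) by (rule minus_unique[symmetric])

lemma gen_cb: "gen_c * gen_b = - (gen_b * gen_a + gen_a * gen_c)"
  using gen_cyclic(2) by (rule minus_unique[symmetric])

lemma gen_reduce_left:
  "gen g * (gen g * x) = 0"
  "gen_c * (gen_a * x) = - (gen_a * (gen_b * x) + gen_b * (gen_c * x))"
  "gen_c * (gen_b * x) = - (gen_b * (gen_a * x) + gen_a * (gen_c * x))"
  unfolding mult.assoc[symmetric] gen_square gen_ca gen_cb
  by (simp_all only: mult_zero_left distrib_right mult_minus_left)

text \<open>The overlap \<open>cbb\<close> resolved in two ways: \<open>bb = 0\<close> gives 0,
  \<open>cb\<close> gives \<open>-(bab + acb)\<close>, and \<open>acb = -aba\<close>.\<close>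

lemma gen_bab: "gen_b * (gen_a * gen_b) = gen_a * (gen_b * gen_a)"
proof -
  have "gen_c * gen_b * gen_b = (0 :: 'a fk3)"
    by (simp only: gen_square mult_zero_right mult.assoc)
  moreover have "gen_b * (gen_a * gen_b) + gen_a * (gen_c * gen_b) = - (gen_c * gen_b * gen_b :: 'a fk3)"
    by (simp only: gen_cb distrib_right mult_minus_left minus_minus mult.assoc)
  ultimately show ?thesis
    by (simp add: gen_cb distrib_left right_diff_distrib gen_reduce_left)
qed

lemma gen_bab_left: "gen_b * (gen_a * (gen_b * x)) = gen_a * (gen_b * (gen_a * x))"
  using arg_cong[OF gen_bab, of "\<lambda>y. y * x"] by (simp only: mult.assoc)

text \<open>A confluent system; the normal words are \<open>1, a, b, c, ab, bc, ba, ac, aba, abc, bac, abac\<close>.\<close>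

lemmas gen_reduce = mult.assoc distrib_left right_diff_distrib gen_square gen_ca gen_cb gen_bab gen_reduce_left
  gen_bab_left

section \<open>Multiplication into the top degree\<close>

definition bac :: "'k::field fk3" where "bac = gen_b * gen_a * gen_c"
definition socle :: "'k::field fk3" where "socle = gen_a * gen_b * gen_a * gen_c"

lemma gen_mult_bac:
  "gen_a * bac = socle" "gen_b * bac = 0" "gen_c * bac = 0"
  by (simp_all add: bac_def socle_def gen_reduce)

lemma bac_mult_gen:
  "bac * gen_a = - socle" "bac * gen_b = 0" "bac * gen_c = 0"
  by (simp_all add: bac_def socle_def gen_reduce)

lemma socle_mult_gen: "socle * gen g = 0" "gen g * socle = 0"
  by (cases g; simp add: socle_def gen_reduce)+


lemma socle_eq_mon: "socle = fk3_mon [Gen_a, Gen_b, Gen_a, Gen_c]"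
  by (simp add: socle_def mult.assoc)

lemma bac_eq_mon: "bac = fk3_mon [Gen_b, Gen_a, Gen_c]"
  by (simp add: bac_def mult.assoc)

lemma socle_mult_mon: "socle * fk3_mon w = (if w = [] then socle else 0)"
  by (cases w) (simp_all add: socle_mult_gen flip: mult.assoc)

lemma mon_mult_socle: "fk3_mon w * socle = (if w = [] then socle else 0)"
  by (cases w rule: rev_cases) (simp_all add: fk3_mon_append mult.assoc socle_mult_gen)

lemma mon_mult_bac:
  "fk3_mon w * bac = (if w = [] then bac else if w = [Gen_a] then socle else 0)"
proof (cases w rule: rev_cases)
  case (snoc u g)
  then show ?thesis
    by (cases g) (simp_all add: fk3_mon_append mult.assoc gen_mult_bac mon_mult_socle)
qed simp

lemma bac_mult_mon:
  "bac * fk3_mon w = (if w = [] then bac else if w = [Gen_a] then - socle else 0)"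
proof (cases w)
  case (Cons g u)
  then show ?thesis
    by (cases g) (simp_all add: mult.assoc[symmetric] bac_mult_gen socle_mult_mon)
qed simp

text \<open>Both sides see only the constant term of \<open>x\<close>: letters annihilate
  \<open>socle\<close>, and \<open>gen_a * bac\<close> is already \<open>socle\<close>.\<close>

lemma a_mult_bac: "gen_a * (x * bac) = socle * x"
proof (induction x rule: fk3_induct)
  case (mon w)
  then show ?case
    by (simp add: mon_mult_bac socle_mult_mon gen_mult_bac socle_mult_gen)
qed (simp_all add: distrib_left distrib_right fk3.scale_mult_left fk3.scale_mult_right)

text \<open>Both sides see only the constant term of \<open>x\<close>, because \<open>t\<close>
  sends every letter to 0 or to \<open>socle\<close> up to sign, and letters annihilate
  \<open>socle\<close>. This replaces commuting \<open>x\<close> past \<open>gen h\<close>.\<close>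

lemma detect_constant_term:
  assumes "t * gen h = socle \<or> t * gen h = - socle" and "\<And>g. g \<noteq> h \<Longrightarrow> t * gen g = 0"
  shows "t * x * gen h = t * gen h * x"
proof (induction x rule: fk3_induct)
  case (mon w)
  show ?case
  proof (cases w)
    case (Cons g u)
    have "t * gen g = 0 \<or> t * gen g = socle \<or> t * gen g = - socle"
      using assms by (cases "g = h") auto
    moreover have "t * fk3_mon w * gen h = t * gen g * fk3_mon (u @ [h])"
      by (simp add: Cons fk3_mon_append mult.assoc)
    ultimately have "t * fk3_mon w * gen h = 0"
      by (auto simp: socle_mult_mon)
    moreover have "t * gen h * fk3_mon w = 0"
      using assms(1) Cons by (auto simp: socle_mult_mon simp del: fk3_mon.simps)
    ultimately show ?thesis
      by simp
  qed simp
qed (simp_all add: distrib_left distrib_right fk3.scale_mult_left fk3.scale_mult_right)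

text \<open>Up to sign, \<open>bac\<close>, \<open>abc\<close> and \<open>aba\<close> are dual to
  the letters \<open>a\<close>, \<open>b\<close> and \<open>c\<close> under the product of degrees 3
  and 1 into the socle.\<close>

lemma exists_detector:
  "\<exists>t. (t * gen h = (socle :: 'k::field fk3) \<or> t * gen h = - socle) \<and> (\<forall>g. g \<noteq> h \<longrightarrow> t * gen g = 0)"
proof -
  define t :: "'k fk3"
    where "t = (case h of Gen_a \<Rightarrow> bac | Gen_b \<Rightarrow> gen_a * gen_b * gen_c | Gen_c \<Rightarrow> gen_a * gen_b * gen_a)"
  have "t * gen h = socle \<or> t * gen h = - socle"
    by (cases h) (simp_all add: t_def bac_mult_gen socle_def gen_reduce)
  moreover have "t * gen g = 0" if "g \<noteq> h" for g
    using that by (cases h; cases g) (simp_all add: t_def bac_mult_gen gen_reduce)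
  ultimately show ?thesis
    by blast
qed

lemma numeral_2_neq_0: "CHAR('k::field) \<noteq> 2 \<Longrightarrow> (2 :: 'k) \<noteq> 0"
  using of_nat_eq_0_iff_char_dvd[where 'a = 'k, of 2] CHAR_not_1[where 'a = 'k]
  by (auto dest: dvd_imp_le simp: le_Suc_eq numeral_2_eq_2)

lemma fk3_double_eq_0:
  assumes "CHAR('k::field) \<noteq> 2" "x + x = (0 :: 'k fk3)"
  shows "x = 0"
proof -
  have "fk3_scale (1 + 1) x = x + x"
    by (simp only: fk3.scale_left_distrib fk3.scale_one)
  with assms numeral_2_neq_0[OF assms(1)] show ?thesis
    by simp
qed

text \<open>Applying \<open>f\<close> to \<open>gen h * gen h = 0\<close> and multiplying by a
  detector gives, up to sign, twice \<open>socle * f (gen h)\<close>. So values on letters have no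
  constant term, and the Leibniz rule extends this to words.\<close>

lemma socle_mult_derivation:
  fixes f :: "'k::field fk3 \<Rightarrow> 'k fk3"
  assumes char: "CHAR('k) \<noteq> 2" and lin: "fk3_linear f"
    and deriv: "\<And>x y. f (x * y) = x * f y + f x * y"
  shows "socle * f x = 0"
proof -
  interpret f: Vector_Spaces.linear fk3_scale fk3_scale f by (rule lin)
  have f1: "f 1 = 0"
    using deriv[of 1 1] by simp
  have gen: "socle * f (gen h) = 0" for h
  proof -
    obtain t :: "'k fk3" where t: "t * gen h = socle \<or> t * gen h = - socle" "\<And>g. g \<noteq> h \<Longrightarrow> t * gen g = 0"
      using exists_detector[of h] by blast
    have "0 = t * f (gen h * gen h)"
      by (simp add: gen_square f.zero)
    also have "\<dots> = t * gen h * f (gen h) + t * f (gen h) * gen h"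
      by (simp add: deriv distrib_left mult.assoc)
    also have "t * f (gen h) * gen h = t * gen h * f (gen h)"
      by (rule detect_constant_term[OF t])
    finally have "t * gen h * f (gen h) = 0"
      using fk3_double_eq_0[OF char] by metis
    with t(1) show ?thesis
      by auto
  qed
  have "socle * f (fk3_mon w) = 0" for w
    by (cases w) (simp_all add: f1 deriv distrib_left gen socle_mult_gen flip: mult.assoc)
  then show ?thesis
    by (induction x rule: fk3_induct) (simp_all add: f.add f.scale distrib_left fk3.scale_mult_right)
qed

section \<open>Twisted derivations\<close>

text \<open>For distinct letters one has \<open>xyxz = s\<close> and \<open>xyzy = -s\<close>; other words of length 4 vanish.\<close>

definition socle_coeff_mon :: "fk3_gen list \<Rightarrow> 'k::field fk3"
  where "socle_coeff_mon w = (case w of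
      [p, q, r, t] \<Rightarrow> if p = r \<and> distinct [p, q, t] then 1
        else if q = t \<and> distinct [p, q, r] then - 1 else 0
    | _ \<Rightarrow> 0)"

text \<open>Maps built by \<open>fk3_lift\<close> take values in \<open>A\<close>, so the
  coefficient of \<open>socle\<close> is encoded as a multiple of \<open>1\<close>.\<close>

definition socle_coeff :: "'k::field fk3 \<Rightarrow> 'k fk3"
  where "socle_coeff = fk3_lift socle_coeff_mon"

definition euler :: "'k::field fk3 \<Rightarrow> 'k fk3"
  where "euler = fk3_lift (\<lambda>w. fk3_scale (of_nat (length w)) (fk3_mon w))"

text \<open>Zero on longer words is what the Leibniz rule forces: \<open>b\<close> and
  \<open>c\<close> annihilate \<open>bac\<close> on both sides,
  \<open>a * bac + bac * a = 0\<close>, and words of length at least 3 would land beyond degree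
  4.\<close>

definition deriv_a :: "'k::field fk3 \<Rightarrow> 'k fk3"
  where "deriv_a = fk3_lift (\<lambda>w. if w = [Gen_a] then bac else 0)"

fun twist_gen :: "fk3_gen \<Rightarrow> 'k::field fk3"
  where
    "twist_gen Gen_a = - gen_a"
  | "twist_gen Gen_b = - gen_c"
  | "twist_gen Gen_c = - gen_b"

primrec twist_mon :: "fk3_gen list \<Rightarrow> 'k::field fk3"
  where
    "twist_mon [] = 1"
  | "twist_mon (g # w) = twist_gen g * twist_mon w"

definition twist :: "'k::field fk3 \<Rightarrow> 'k fk3"
  where "twist = fk3_lift twist_mon"

text \<open>The twist is chosen to make the relators vanish under
  \<open>x * f y + f x * twist y\<close>: \<open>aa\<close> goes to \<open>a - a\<close>,
  \<open>ab + bc + ca\<close> to \<open>-c + c\<close>, and \<open>ba + ac + cb\<close> to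
  \<open>b - b\<close>.\<close>

primrec skew_right_mon :: "fk3_gen list \<Rightarrow> 'k::field fk3"
  where
    "skew_right_mon [] = 0"
  | "skew_right_mon (g # w) = gen g * skew_right_mon w + (if g = Gen_a then twist_mon w else 0)"

definition skew_right :: "'k::field fk3 \<Rightarrow> 'k fk3"
  where "skew_right = fk3_lift skew_right_mon"

primrec skew_left_mon :: "fk3_gen list \<Rightarrow> 'k::field fk3"
  where
    "skew_left_mon [] = 0"
  | "skew_left_mon (g # w) = twist_gen g * skew_left_mon w + (if g = Gen_a then fk3_mon w else 0)"

definition skew_left :: "'k::field fk3 \<Rightarrow> 'k fk3"
  where "skew_left = fk3_lift skew_left_mon"

section \<open>Product rules on words and compatibility with the relators\<close>

lemma twist_mon_append: "twist_mon (u @ v) = twist_mon u * twist_mon v"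
  by (induction u) (simp_all add: mult.assoc)

lemma skew_right_mon_append:
  "skew_right_mon (u @ v) = fk3_mon u * skew_right_mon v + skew_right_mon u * twist_mon v"
  by (induction u) (simp_all add: algebra_simps twist_mon_append)

lemma skew_left_mon_append:
  "skew_left_mon (u @ v) = twist_mon u * skew_left_mon v + skew_left_mon u * fk3_mon v"
  by (induction u) (simp_all add: algebra_simps fk3_mon_append)

lemma mon_relators:
  "gen g * (gen g * x) = 0"
  "gen_a * (gen_b * x) + gen_b * (gen_c * x) + gen_c * (gen_a * x) = 0"
  "gen_b * (gen_a * x) + gen_a * (gen_c * x) + gen_c * (gen_b * x) = 0"
  by (simp_all add: gen_reduce_left)

text \<open>The signs cancel in degree 2, and exchanging \<open>b\<close> and \<open>c\<close>
  exchanges the two cyclic relators.\<close>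

lemma twist_relators:
  "twist_gen g * (twist_gen g * x) = 0"
  "twist_gen Gen_a * (twist_gen Gen_b * x) + twist_gen Gen_b * (twist_gen Gen_c * x)
    + twist_gen Gen_c * (twist_gen Gen_a * x) = 0"
  "twist_gen Gen_b * (twist_gen Gen_a * x) + twist_gen Gen_a * (twist_gen Gen_c * x)
    + twist_gen Gen_c * (twist_gen Gen_b * x) = 0"
  by (cases g) (simp_all add: gen_reduce_left)

lemma respects_fk3_mon: "respects_relators fk3_mon"
  by (simp add: respects_relators_def fk3_mon_append mon_relators flip: distrib_left)

lemma respects_twist_mon: "respects_relators twist_mon"
  by (simp add: respects_relators_def twist_mon_append twist_relators del: twist_gen.simps
      flip: distrib_left)

lemma respects_skew_right_mon: "respects_relators skew_right_mon"
  unfolding respects_relators_def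
proof (intro allI conjI)
  fix u v
  show "skew_right_mon (u @ [g, g] @ v) = 0" for g
    by (cases g) (simp_all add: skew_right_mon_append distrib_left gen_reduce_left)
  show "skew_right_mon (u @ [Gen_a, Gen_b] @ v) + skew_right_mon (u @ [Gen_b, Gen_c] @ v)
      + skew_right_mon (u @ [Gen_c, Gen_a] @ v) = 0"
    "skew_right_mon (u @ [Gen_b, Gen_a] @ v) + skew_right_mon (u @ [Gen_a, Gen_c] @ v)
      + skew_right_mon (u @ [Gen_c, Gen_b] @ v) = 0"
    by (simp_all add: skew_right_mon_append distrib_left right_diff_distrib gen_reduce_left)
qed

lemma respects_skew_left_mon: "respects_relators skew_left_mon"
  unfolding respects_relators_def
proof (intro allI conjI)
  fix u v
  show "skew_left_mon (u @ [g, g] @ v) = 0" for g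
    by (cases g) (simp_all add: skew_left_mon_append distrib_left right_diff_distrib gen_reduce_left)
  show "skew_left_mon (u @ [Gen_a, Gen_b] @ v) + skew_left_mon (u @ [Gen_b, Gen_c] @ v)
      + skew_left_mon (u @ [Gen_c, Gen_a] @ v) = 0"
    "skew_left_mon (u @ [Gen_b, Gen_a] @ v) + skew_left_mon (u @ [Gen_a, Gen_c] @ v)
      + skew_left_mon (u @ [Gen_c, Gen_b] @ v) = 0"
    by (simp_all add: skew_left_mon_append distrib_left right_diff_distrib gen_reduce_left)
qed

text \<open>The words of one relator have equal length, so the length factors out.\<close>

lemma respects_euler: "respects_relators (\<lambda>w. fk3_scale (of_nat (length w)) (fk3_mon w))"
  using respects_fk3_mon unfolding respects_relators_def
  by (simp flip: fk3.scale_right_distrib) blast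

lemma respects_deriv_a: "respects_relators (\<lambda>w. if w = [Gen_a] then bac else 0)"
  by (auto simp: respects_relators_def append_eq_Cons_conv)

lemma socle_coeff_mon_eq_0: "length w \<noteq> 4 \<Longrightarrow> socle_coeff_mon w = 0"
  by (auto simp: socle_coeff_mon_def split: list.splits)

lemma respects_socle_coeff_mon: "respects_relators socle_coeff_mon"
  unfolding respects_relators_def
proof (intro allI, goal_cases)
  case (1 u v)
  show ?case
  \<comment> \<open>Relators have length 2, so only contexts of total length 2 reach words of length
    4.\<close>
  proof (cases "length u + length v = 2")
    case True
    then consider x y where "u = []" "v = [x, y]" | x y where "u = [x]" "v = [y]"
      | x y where "u = [x, y]" "v = []"
      by (cases u rule: remdups_adj.cases; cases v rule: remdups_adj.cases) auto
    then show ?thesis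
    proof cases
      case 1
      then show ?thesis
        by (cases x; cases y) (auto simp: socle_coeff_mon_def)
    next
      case 2
      then show ?thesis
        by (cases x; cases y) (auto simp: socle_coeff_mon_def)
    next
      case 3
      then show ?thesis
        by (cases x; cases y) (auto simp: socle_coeff_mon_def)
    qed
  qed (simp add: socle_coeff_mon_eq_0)
qed

lemmas linear_maps =
  fk3_linear_lift[OF respects_socle_coeff_mon, folded socle_coeff_def]
  fk3_linear_lift[OF respects_euler, folded euler_def]
  fk3_linear_lift[OF respects_deriv_a, folded deriv_a_def]
  fk3_linear_lift[OF respects_twist_mon, folded twist_def]
  fk3_linear_lift[OF respects_skew_right_mon, folded skew_right_def]
  fk3_linear_lift[OF respects_skew_left_mon, folded skew_left_def]

lemma fk3_linearD:
  assumes "fk3_linear f"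
  shows "f (x + y) = f x + f y" "f (fk3_scale s x) = fk3_scale s (f x)"
  using assms by (simp_all add: Vector_Spaces.linear_iff)

lemmas map_simps = linear_maps[THEN fk3_linearD(1)] linear_maps[THEN fk3_linearD(2)]

lemmas map_mon =
  fk3_lift_mon[OF respects_socle_coeff_mon, folded socle_coeff_def]
  fk3_lift_mon[OF respects_euler, folded euler_def]
  fk3_lift_mon[OF respects_deriv_a, folded deriv_a_def]
  fk3_lift_mon[OF respects_twist_mon, folded twist_def]
  fk3_lift_mon[OF respects_skew_right_mon, folded skew_right_def]
  fk3_lift_mon[OF respects_skew_left_mon, folded skew_left_def]

lemmas fk3_bilinear_simps = distrib_left distrib_right fk3.scale_mult_left fk3.scale_mult_right
  fk3.scale_right_distrib

lemma skew_right_mult: "skew_right (x * y) = x * skew_right y + skew_right x * twist y"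
proof (induction x rule: fk3_induct)
  case (mon u)
  show ?case
    by (induction y rule: fk3_induct)
      (simp_all add: map_simps map_mon skew_right_mon_append fk3_bilinear_simps add_ac flip: fk3_mon_append)
qed (simp_all add: map_simps fk3_bilinear_simps add_ac)

lemma skew_left_mult: "skew_left (x * y) = twist x * skew_left y + skew_left x * y"
proof (induction x rule: fk3_induct)
  case (mon u)
  show ?case
    by (induction y rule: fk3_induct)
      (simp_all add: map_simps map_mon skew_left_mon_append fk3_bilinear_simps add_ac flip: fk3_mon_append)
qed (simp_all add: map_simps fk3_bilinear_simps add_ac)

lemma euler_mult: "euler (x * y) = x * euler y + euler x * y"
proof (induction x rule: fk3_induct)
  case (mon u)
  show ?case
    by (induction y rule: fk3_induct)
      (simp_all add: map_simps map_mon fk3_bilinear_simps fk3.scale_left_distrib add_ac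
        flip: fk3_mon_append)
qed (simp_all add: map_simps fk3_bilinear_simps add_ac)

lemma deriv_a_mult: "deriv_a (x * y) = x * deriv_a y + deriv_a x * y"
proof (induction x rule: fk3_induct)
  case (mon u)
  show ?case
  proof (induction y rule: fk3_induct)
    case (mon v)
    show ?case
      by (auto simp: map_mon mon_mult_bac bac_mult_mon append_eq_Cons_conv simp flip: fk3_mon_append
          simp del: fk3_mon.simps)
  qed (simp_all add: map_simps fk3_bilinear_simps add_ac)
qed (simp_all add: map_simps fk3_bilinear_simps add_ac)

section \<open>Values on the socle and products with it\<close>

lemma socle_coeff_socle: "socle_coeff socle = 1"
  unfolding socle_eq_mon map_mon by (simp add: socle_coeff_mon_def)

text \<open>A word with nonzero coefficient has length 4 and different first and last
  letters.\<close>

lemma socle_coeff_sandwich: "socle_coeff (gen_a * x * gen_a) = 0"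
proof (induction x rule: fk3_induct)
  case (mon w)
  have "gen_a * fk3_mon w * gen_a = (fk3_mon (Gen_a # w @ [Gen_a]) :: 'a fk3)"
    by (simp add: fk3_mon_append mult.assoc)
  then show ?case
    by (auto simp: map_mon socle_coeff_mon_def split: list.split simp del: fk3_mon.simps)
qed (simp_all add: map_simps fk3_bilinear_simps)

lemma socle_mult_euler: "socle * euler x = 0"
  by (induction x rule: fk3_induct) (simp_all add: map_simps map_mon fk3_bilinear_simps socle_mult_mon)

lemma socle_mult_twist_mon: "socle * twist_mon w = (if w = [] then socle else 0)"
proof (cases w)
  case (Cons g u)
  then show ?thesis
    by (cases g) (simp_all add: socle_mult_gen flip: mult.assoc)
qed simp

lemma socle_mult_skew_right_mon: "socle * skew_right_mon w = (if w = [Gen_a] then socle else 0)"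
  by (cases w) (simp_all add: distrib_left socle_mult_gen socle_mult_twist_mon flip: mult.assoc)

lemma socle_mult_skew_left_mon: "socle * skew_left_mon w = (if w = [Gen_a] then socle else 0)"
proof (cases w)
  case (Cons g u)
  then show ?thesis
    by (cases g) (simp_all add: right_diff_distrib socle_mult_gen socle_mult_mon flip: mult.assoc)
qed simp

lemma euler_mon_mult_bac: "euler (fk3_mon w) * bac = (if w = [Gen_a] then socle else 0)"
  by (simp add: map_mon fk3.scale_mult_left mon_mult_bac del: fk3_mon.simps)

text \<open>On pairs of words both sides are \<open>socle\<close> at (\<open>a\<close>,
  \<open>a\<close>) and 0 elsewhere: on the left \<open>socle\<close> keeps constant terms only, on
  the right \<open>a * bac\<close> is the sole survivor. Hence \<open>SF = ED\<close> holds already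
  for cochains.\<close>

lemma socle_mult_skew: "socle * (skew_right x * skew_left y) = euler x * deriv_a y"
proof (induction x rule: fk3_induct)
  case (mon u)
  show ?case
  proof (induction y rule: fk3_induct)
    case (mon v)
    have "socle * (skew_right (fk3_mon u) * skew_left (fk3_mon v)) =
      (if u = [Gen_a] \<and> v = [Gen_a] then socle else 0 :: 'a fk3)"
      by (simp add: map_mon socle_mult_skew_right_mon socle_mult_skew_left_mon flip: mult.assoc)
    also have "\<dots> = euler (fk3_mon u) * deriv_a (fk3_mon v)"
      by (simp add: map_mon(3) euler_mon_mult_bac del: fk3_mon.simps)
    finally show ?case .
  qed (simp_all add: map_simps fk3_bilinear_simps)
qed (simp_all add: map_simps fk3_bilinear_simps)

lemma euler_socle: "euler socle = fk3_scale 4 socle"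
  unfolding socle_eq_mon map_mon by (simp add: mult.assoc)

lemma skew_right_socle: "skew_right socle = - bac"
  unfolding socle_eq_mon map_mon by (simp add: bac_def gen_reduce)

lemma skew_left_socle: "skew_left socle = bac"
  unfolding socle_eq_mon map_mon by (simp add: bac_def gen_reduce)

text \<open>\<open>deriv_a\<close> takes values in degree 3 and sees only degree 1. The factor 3
  here and the factor 1 in \<open>deriv_a_euler\<close> differ by the 2 in
  \<open>[E,D] = 2D\<close>.\<close>

lemma euler_deriv_a: "euler (deriv_a x) = fk3_scale 3 (deriv_a x)"
proof (induction x rule: fk3_induct)
  case (mon w)
  have "euler bac = (fk3_scale 3 bac :: 'a fk3)"
    unfolding bac_eq_mon map_mon by simp
  moreover have "euler 0 = (0 :: 'a fk3)"
    using map_simps(8)[of 0 "0 :: 'a fk3"] by simp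
  ultimately show ?case
    by (simp add: map_mon)
qed (simp_all add: map_simps fk3.scale_right_distrib mult.commute)

lemma deriv_a_euler: "deriv_a (euler x) = deriv_a x"
  by (induction x rule: fk3_induct) (simp_all add: map_simps map_mon fk3_bilinear_simps)

text \<open>The delicate word is \<open>aa\<close>, where \<open>- bac * a\<close> and
  \<open>bac * a\<close> cancel. With \<open>skew_right_mult_bac\<close> this makes each of the two
  terms of \<open>[s,F]\<close> equal to \<open>-D\<close>.\<close>

lemma bac_mult_skew_left: "bac * skew_left x = deriv_a x"
proof (induction x rule: fk3_induct)
  case (mon w)
  show ?case
  proof (cases w)
    case (Cons g u)
    then show ?thesis
      by (cases g) (simp_all add: map_mon right_diff_distrib bac_mult_gen bac_mult_mon
          socle_mult_skew_left_mon flip: mult.assoc del: fk3_mon.simps)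
  qed (simp add: map_mon del: fk3_mon.simps)
qed (simp_all add: map_simps fk3_bilinear_simps)

lemma skew_right_mon_mult_socle: "skew_right_mon w * socle = (if w = [Gen_a] then socle else 0)"
proof (cases w rule: rev_cases)
  case (snoc u g)
  then show ?thesis
    by (cases g) (simp_all add: skew_right_mon_append distrib_right left_diff_distrib mult.assoc
        socle_mult_gen mon_mult_socle)
qed simp

lemma skew_right_mult_bac: "skew_right x * bac = deriv_a x"
proof (induction x rule: fk3_induct)
  case (mon w)
  show ?case
  proof (cases w rule: rev_cases)
    case (snoc u g)
    then show ?thesis
      by (cases g) (simp_all add: map_mon skew_right_mon_append left_diff_distrib mult.assoc
          gen_mult_bac mon_mult_bac skew_right_mon_mult_socle del: fk3_mon.simps)
  qed (simp add: map_mon del: fk3_mon.simps)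
qed (simp_all add: map_simps fk3_bilinear_simps)

section \<open>Cochains of low degree\<close>

definition nullary :: "'k::field fk3 \<Rightarrow> 'k fk3 cochain"
  where "nullary z xs = (if xs = [] then z else 0)"

definition unary :: "('k::field fk3 \<Rightarrow> 'k fk3) \<Rightarrow> 'k fk3 cochain"
  where "unary f xs = (case xs of [x] \<Rightarrow> f x | _ \<Rightarrow> 0)"

lemma nullary_simps [simp]: "nullary z [] = z" "nullary z (x # xs) = 0"
  by (simp_all add: nullary_def)

lemma unary_simps [simp]: "unary f [] = 0" "unary f [x] = f x" "unary f (x # y # xs) = 0"
  by (simp_all add: unary_def)

lemma homogeneous_nullary: "homogeneous 0 (nullary z)"
  by (simp add: homogeneous_def nullary_def)

lemma homogeneous_unary: "homogeneous 1 (unary f)"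
  by (auto simp: homogeneous_def unary_def split: list.splits)

lemma homogeneousD: "homogeneous n f \<Longrightarrow> length xs \<noteq> n \<Longrightarrow> f xs = 0"
  by (simp add: homogeneous_def)

lemma homogeneous_0_eq_nullary: "homogeneous 0 f \<Longrightarrow> f = nullary (f [])"
  by (rule ext) (simp add: homogeneous_def nullary_def)

lemma homogeneous_1_eq_unary: "homogeneous 1 f \<Longrightarrow> f = unary (\<lambda>x. f [x])"
  by (rule ext) (auto simp: homogeneous_def unary_def split: list.splits)

lemma multilinear_nullary: "multilinear fk3_scale (nullary z)"
  by (simp add: multilinear_def nullary_def)

lemma multilinear_unary:
  assumes "fk3_linear f"
  shows "multilinear fk3_scale (unary f)"
  unfolding multilinear_def
proof (intro allI)
  fix us ws and s :: 'a and x y :: "'a fk3"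
  show "unary f (us @ (fk3_scale s x + y) # ws) =
    fk3_scale s (unary f (us @ x # ws)) + unary f (us @ y # ws)"
    by (cases us rule: remdups_adj.cases; cases ws) (simp_all add: fk3_linearD[OF assms])
qed

lemma cup_nullary_left: "cup (nullary z) f = (\<lambda>xs. z * f xs)"
  by (rule ext) (simp add: cup_eq_split_sum split_sum_Nil nullary_def)

lemma cup_nullary_right: "cup f (nullary z) = (\<lambda>xs. f xs * z)"
  by (rule ext) (simp add: cup_eq_split_sum split_sum_Nil_right nullary_def)

lemma cup_unary_2: "cup (unary f) (unary g) [x, y] = f x * g y"
  by (simp add: cup_eq_split_sum)

lemma homogeneous_cup:
  assumes "homogeneous m f" "homogeneous n g"
  shows "homogeneous (m + n) (cup f g)"
  unfolding homogeneous_def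
proof (intro allI impI)
  fix xs :: "'a list"
  assume "length xs \<noteq> m + n"
  then have "f u * g v = 0" if "u @ v = xs" for u v
    using assms that by (cases "length u = m") (auto simp: homogeneous_def)
  then show "cup f g xs = 0"
    unfolding cup_eq_split_sum by (rule split_sum_eq_0)
qed

lemma homogeneous_cup_unary: "homogeneous 2 (cup (unary f) (unary g))"
  using homogeneous_cup[OF homogeneous_unary homogeneous_unary, of f g]
  by (simp only: one_add_one)

lemma cocycle_nullary:
  assumes "\<And>x. x * z = z * x"
  shows "nullary z \<in> cocycles fk3_scale"
proof (rule fk3.cocyclesI)
  show "nullary z \<in> cochains fk3_scale"
    by (rule fk3.cochains_homogeneous[OF multilinear_nullary homogeneous_nullary])
  show "coboundary (nullary z) xs = 0" for xs
  proof (cases "length xs = 1")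
    case True
    then obtain x where "xs = [x]"
      by (auto simp: length_Suc_conv)
    then show ?thesis
      by (simp add: coboundary_def assms)
  next
    case False
    then show ?thesis
      by (intro homogeneousD[OF homogeneous_coboundary[OF homogeneous_nullary]]) simp
  qed
qed

lemma coboundary_unary: "coboundary (unary f) [x, y] = x * f y - f (x * y) + f x * y"
  by (simp add: coboundary_def)

lemma cocycle_unary:
  assumes "fk3_linear f" and "\<And>x y. f (x * y) = x * f y + f x * y"
  shows "unary f \<in> cocycles fk3_scale"
proof (rule fk3.cocyclesI)
  show "unary f \<in> cochains fk3_scale"
    by (rule fk3.cochains_homogeneous[OF multilinear_unary[OF assms(1)] homogeneous_unary])
  show "coboundary (unary f) xs = 0" for xs
  proof (cases "length xs = 2")
    case True
    then obtain x y where "xs = [x, y]"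
      by (auto simp: numeral_2_eq_2 length_Suc_conv)
    then show ?thesis
      by (simp add: coboundary_unary assms(2))
  next
    case False
    then show ?thesis
      by (intro homogeneousD[OF homogeneous_coboundary[OF homogeneous_unary]]) simp
  qed
qed

lemma cocycle_unaryD:
  assumes "unary f \<in> cocycles fk3_scale"
  shows "fk3_linear f" "f (x * y) = x * f y + f x * y"
proof -
  have ml: "f (fk3_scale s u + v) = fk3_scale s (f u) + f v" for s u v
    using fk3.cochains_multilinear[OF fk3.cocycles_cochains[OF assms]]
    unfolding multilinear_def by (metis append_Nil unary_simps(2))
  have "f (fk3_scale 1 0 + 0) = fk3_scale 1 (f 0) + f 0"
    by (rule ml)
  then have "f 0 = 0"
    by simp
  with ml[of 1] ml[of _ _ 0] show "fk3_linear f"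
    by (intro fk3_linearI) simp_all
  show "f (x * y) = x * f y + f x * y"
    using fun_cong[OF fk3.coboundary_cocycle[OF assms], of "[x, y]"]
    by (simp add: coboundary_unary algebra_simps)
qed

text \<open>The twists cancel: a right and a left \<open>\<sigma>\<close>-derivation have an untwisted product.\<close>

lemma cocycle_cup_skew: "cup (unary skew_right) (unary skew_left) \<in> cocycles fk3_scale"
proof (rule fk3.cocyclesI)
  let ?F = "cup (unary skew_right) (unary skew_left) :: 'a fk3 cochain"
  show "?F \<in> cochains fk3_scale"
    by (intro fk3.cochains_cup fk3.cochains_homogeneous[OF multilinear_unary homogeneous_unary]
        linear_maps)
  show "coboundary ?F xs = 0" for xs
  proof (cases "length xs = 3")
    case True
    then obtain x y z where "xs = [x, y, z]"
      by (auto simp: numeral_3_eq_3 length_Suc_conv)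
    then show ?thesis
      by (simp add: coboundary_def cup_unary_2 skew_right_mult skew_left_mult algebra_simps
          numeral_2_eq_2)
  next
    case False
    then show ?thesis
      by (intro homogeneousD[OF homogeneous_coboundary[OF homogeneous_cup_unary]]) simp
  qed
qed

lemma socle_central: "x * socle = socle * x"
  by (induction x rule: fk3_induct)
    (simp_all add: mon_mult_socle socle_mult_mon fk3_bilinear_simps)

lemmas basic_cocycles = cocycle_cup_skew
  cocycle_nullary[OF socle_central]
  cocycle_unary[OF linear_maps(2) euler_mult]
  cocycle_unary[OF linear_maps(3) deriv_a_mult]

section \<open>Cup products and brackets of the four basic cocycles\<close>

lemma cup_socle_euler: "cup (nullary socle) (unary euler) = (\<lambda>xs. 0)"
  by (rule ext) (simp add: cup_nullary_left unary_def socle_mult_euler split: list.split)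

lemma cup_socle_skew:
  "cup (nullary socle) (cup (unary skew_right) (unary skew_left)) = cup (unary euler) (unary deriv_a)"
proof
  fix xs :: "'a fk3 list"
  show "cup (nullary socle) (cup (unary skew_right) (unary skew_left)) xs =
    cup (unary euler) (unary deriv_a) xs"
  proof (cases "length xs = 2")
    case True
    then obtain x y where "xs = [x, y]"
      by (auto simp: numeral_2_eq_2 length_Suc_conv)
    then show ?thesis
      by (simp add: cup_nullary_left cup_unary_2 socle_mult_skew)
  next
    case False
    then show ?thesis
      by (simp add: cup_nullary_left homogeneousD[OF homogeneous_cup_unary])
  qed
qed

text \<open>A 0-cochain has no slot for insertion, so only \<open>euler\<close> applied to
  \<open>socle\<close> remains.\<close>

lemma bracket_socle_euler:
  "gerst_bracket (nullary socle) (unary euler) = (\<lambda>xs. - nullary (fk3_scale 4 socle) xs)"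
proof
  fix xs :: "'a fk3 list"
  show "gerst_bracket (nullary socle) (unary euler) xs = - nullary (fk3_scale 4 socle) xs"
    unfolding fk3.gerst_bracket_homogeneous_circ[OF multilinear_nullary homogeneous_nullary
        multilinear_unary[OF linear_maps(2)] homogeneous_unary]
    by (cases xs) (simp_all add: gerst_circ_def euler_socle)
qed

lemma bracket_euler_deriv_a:
  "gerst_bracket (unary euler) (unary deriv_a) = (\<lambda>xs. unary deriv_a xs + unary deriv_a xs)"
proof
  fix xs :: "'a fk3 list"
  have "fk3_scale 3 x = x + x + (x :: 'a fk3)" for x
    using fk3.scale_left_distrib[of 1 1 x] fk3.scale_left_distrib[of 2 1 x] by simp
  then show "gerst_bracket (unary euler) (unary deriv_a) xs = unary deriv_a xs + unary deriv_a xs"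
    unfolding fk3.gerst_bracket_homogeneous_circ[OF multilinear_unary[OF linear_maps(2)]
        homogeneous_unary multilinear_unary[OF linear_maps(3)] homogeneous_unary]
    by (cases xs rule: remdups_adj.cases) (simp_all add: gerst_circ_def euler_deriv_a deriv_a_euler)
qed

text \<open>What remains is \<open>F(s,x) - F(x,s)\<close>; the sign alternates because the inserted
  cochain has arity 0.\<close>

lemma bracket_socle_skew:
  "gerst_bracket (nullary socle) (cup (unary skew_right) (unary skew_left)) =
    (\<lambda>xs. - (unary deriv_a xs + unary deriv_a xs))"
proof
  fix xs :: "'a fk3 list"
  have ml: "multilinear fk3_scale (cup (unary skew_right) (unary skew_left) :: 'a fk3 cochain)"
    by (intro fk3.multilinear_cup multilinear_unary linear_maps)
  show "gerst_bracket (nullary socle) (cup (unary skew_right) (unary skew_left)) xs =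
    - (unary deriv_a xs + unary deriv_a xs)"
    unfolding fk3.gerst_bracket_homogeneous_circ[OF multilinear_nullary homogeneous_nullary ml
        homogeneous_cup_unary]
    by (cases xs rule: remdups_adj.cases)
      (simp_all add: gerst_circ_def cup_unary_2 skew_right_socle skew_left_socle bac_mult_skew_left
        skew_right_mult_bac numeral_2_eq_2)
qed

section \<open>Cohomology classes\<close>

text \<open>\<open>hh\<close> is a partial quotient, and only cocycles represent classes.\<close>

lemma abs_hh_eq_iff:
  assumes "f \<in> cocycles fk3_scale" "g \<in> cocycles fk3_scale"
  shows "abs_hh f = abs_hh g \<longleftrightarrow> (\<lambda>xs. f xs - g xs) \<in> coboundaries fk3_scale"
  using Quotient3_rel[OF Quotient3_hh, of f g] assms cohomologous_refl
  by (auto simp: cohomologous_def)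

lemma abs_hh_ops:
  assumes "f \<in> cocycles fk3_scale" "g \<in> cocycles fk3_scale"
  shows "abs_hh f * abs_hh g = abs_hh (cup f g)"
    and "abs_hh f + abs_hh g = abs_hh (\<lambda>xs. f xs + g xs)"
    and "hh_bracket (abs_hh f) (abs_hh g) = abs_hh (gerst_bracket f g)"
  using assms[THEN cohomologous_refl]
  by (simp_all add: times_hh.abs_eq plus_hh.abs_eq hh_bracket.abs_eq)

lemma abs_hh_minus: "f \<in> cocycles fk3_scale \<Longrightarrow> - abs_hh f = abs_hh (\<lambda>xs. - f xs)"
  by (simp add: uminus_hh.abs_eq cohomologous_refl)

lemma abs_hh_degree:
  "f \<in> cocycles fk3_scale \<Longrightarrow> homogeneous n f \<Longrightarrow> abs_hh f \<in> hh_degree n"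
  by (auto simp: hh_degree_def)

lemma hh_degree_0E:
  assumes "x \<in> hh_degree 0"
  obtains z where "nullary z \<in> cocycles fk3_scale" "x = abs_hh (nullary z)"
proof -
  obtain f where f: "f \<in> cocycles fk3_scale" "homogeneous 0 f" "x = abs_hh f"
    using assms by (auto simp: hh_degree_def)
  show thesis
    using that[of "f []"] f by (simp flip: homogeneous_0_eq_nullary)
qed

lemma hh_degree_1E:
  assumes "x \<in> hh_degree 1"
  obtains f where "unary f \<in> cocycles fk3_scale" "x = abs_hh (unary f)"
proof -
  obtain f where f: "f \<in> cocycles fk3_scale" "homogeneous 1 f" "x = abs_hh f"
    using assms by (auto simp: hh_degree_def)
  show thesis
    using that[of "\<lambda>x. f [x]"] f by (simp flip: homogeneous_1_eq_unary)
qed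

section \<open>Nonexistence of a generator of the bracket\<close>

lemma not_generates_bracket:
  fixes \<Delta> :: "'k::field hh \<Rightarrow> 'k hh"
  assumes char: "CHAR('k) \<noteq> 2"
  shows "\<not> generates_bracket \<Delta>"
proof
  assume "generates_bracket \<Delta>"
  then have lin: "Vector_Spaces.linear hh_scale hh_scale \<Delta>"
    and deg0: "\<And>x. x \<in> hh_degree 0 \<Longrightarrow> \<Delta> x = 0"
    and deg: "\<And>n x. x \<in> hh_degree (Suc n) \<Longrightarrow> \<Delta> x \<in> hh_degree n"
    and gen: "\<And>m n x y. x \<in> hh_degree m \<Longrightarrow> y \<in> hh_degree n \<Longrightarrow>
      hh_bracket x y = (-1) ^ m * (\<Delta> (x * y) - \<Delta> x * y - (-1) ^ m * x * \<Delta> y)"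
    by (auto simp: generates_bracket_def degree_minus_one_def)
  have \<Delta>0: "\<Delta> 0 = 0"
    using lin by (simp add: Vector_Spaces.linear_iff) (metis add_cancel_left_left)
  let ?s = "nullary (socle :: 'k fk3)" and ?e = "unary (euler :: 'k fk3 \<Rightarrow> _)"
    and ?d = "unary (deriv_a :: 'k fk3 \<Rightarrow> _)"
    and ?f = "cup (unary skew_right) (unary skew_left) :: 'k fk3 cochain"
  note cocycle = basic_cocycles[where 'a = 'k]
  define S E D F where "S = abs_hh ?s" and "E = abs_hh ?e" and "D = abs_hh ?d" and "F = abs_hh ?f"
  note defs = S_def E_def D_def F_def
  have degS: "S \<in> hh_degree 0" and degE: "E \<in> hh_degree 1" and degD: "D \<in> hh_degree 1"
    unfolding defs by (intro abs_hh_degree cocycle homogeneous_nullary homogeneous_unary)+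
  have degF: "F \<in> hh_degree 2"
    unfolding defs by (intro abs_hh_degree cocycle homogeneous_cup_unary)
  \<comment> \<open>The cocycle conditions make \<open>z\<close> and \<open>w\<close> central
    elements and \<open>g\<close> a derivation.\<close>
  obtain z where z: "nullary z \<in> cocycles fk3_scale" "\<Delta> E = abs_hh (nullary z)"
    using deg[of E 0] degE by (auto elim: hh_degree_0E)
  obtain w where w: "nullary w \<in> cocycles fk3_scale" "\<Delta> D = abs_hh (nullary w)"
    using deg[of D 0] degD by (auto elim: hh_degree_0E)
  obtain g where g: "unary g \<in> cocycles fk3_scale" "\<Delta> F = abs_hh (unary g)"
    using hh_degree_1E[OF deg] degF by (metis Suc_1)

  have "S * E = 0"
    by (simp add: defs abs_hh_ops cocycle cup_socle_euler zero_hh_def)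
  then have "hh_bracket S E = - (S * \<Delta> E)"
    using gen[OF degS degE] deg0[OF degS] by (simp add: \<Delta>0)
  then have "abs_hh (gerst_bracket ?s ?e) = abs_hh (\<lambda>xs. - cup ?s (nullary z) xs)"
    unfolding z(2) unfolding defs by (simp add: z(1) abs_hh_ops abs_hh_minus cocycle fk3.cocycles_cup)
  then have "(\<lambda>xs. gerst_bracket ?s ?e xs - - cup ?s (nullary z) xs) \<in> coboundaries fk3_scale"
    using abs_hh_eq_iff[OF fk3.cocycles_gerst_bracket[OF cocycle(2,3)]
        fk3.cocycles_minus[OF fk3.cocycles_cup[OF cocycle(2) z(1)]]] by simp
  then obtain h where "(\<lambda>xs. gerst_bracket ?s ?e xs - - cup ?s (nullary z) xs) = coboundary h"
    by (rule fk3.coboundariesE)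
  \<comment> \<open>Coboundaries vanish on the empty list, so equal classes in degree 0 give equal
    elements of \<open>A\<close>.\<close>
  from fun_cong[OF this, of "[]"] have sz: "socle * z = fk3_scale 4 socle"
    by (simp add: bracket_socle_euler cup_nullary_left coboundary_def)

  have "S * \<Delta> F = 0"
  proof -
    have "cup ?s (unary g) = (\<lambda>xs. 0)"
      by (rule ext) (simp add: cup_nullary_left unary_def split: list.split,
        simp add: socle_mult_derivation[OF char cocycle_unaryD[OF g(1)]])
    then show ?thesis
      unfolding g(2) unfolding S_def by (simp add: g(1) abs_hh_ops cocycle zero_hh_def)
  qed
  moreover have "S * F = E * D"
    by (simp add: defs abs_hh_ops cocycle cup_socle_skew)
  moreover have "hh_bracket S F = - (D + D)"
    by (simp add: defs abs_hh_ops abs_hh_minus cocycle bracket_socle_skew fk3.cocycles_add)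
  \<comment> \<open>As \<open>\<Delta> S\<close> and \<open>S * \<Delta> F\<close> vanish, the
    identity for \<open>S\<close> and \<open>F\<close> reads
    \<open>[S,F] = \<Delta> (S * F)\<close>.\<close>
  ultimately have "\<Delta> (E * D) = - (D + D)"
    using gen[OF degS degF] deg0[OF degS] by simp
  moreover have "hh_bracket E D = D + D"
    by (simp add: defs abs_hh_ops cocycle bracket_euler_deriv_a)
  \<comment> \<open>The term \<open>- \<Delta> (E * D)\<close> already equals \<open>[E,D]\<close>,
    so the other two terms must cancel.\<close>
  ultimately have "\<Delta> E * D = E * \<Delta> D"
    using gen[OF degE degD] by (simp add: algebra_simps)
  then have "abs_hh (cup (nullary z) ?d) = abs_hh (cup ?e (nullary w))"
    unfolding z(2) w(2) unfolding defs by (simp add: z(1) w(1) abs_hh_ops cocycle)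
  then have "(\<lambda>xs. z * ?d xs - ?e xs * w) \<in> coboundaries fk3_scale"
    using abs_hh_eq_iff[OF fk3.cocycles_cup[OF z(1) cocycle(4)] fk3.cocycles_cup[OF cocycle(3) w(1)]]
    by (simp add: cup_nullary_left cup_nullary_right)
  then obtain h where h: "(\<lambda>xs. z * ?d xs - ?e xs * w) = coboundary h"
    by (rule fk3.coboundariesE)
  \<comment> \<open>On a single element the coboundary of \<open>h\<close> sees only its arity-0
    part.\<close>
  define p where "p = h []"
  have "z * bac - gen_a * w = gen_a * p - p * gen_a"
    using fun_cong[OF h, of "[gen_a]"] map_mon(2,3)[where 'a = 'k, of "[Gen_a]"]
    by (simp add: coboundary_def p_def)
  \<comment> \<open>The factor \<open>a\<close> kills \<open>a * w\<close> and \<open>a * p\<close>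
    and turns \<open>z * bac\<close> into \<open>socle * z = 4 socle\<close>.\<close>
  then have "gen_a * (z * bac - gen_a * w) = gen_a * (gen_a * p - p * gen_a)"
    by simp
  then have "fk3_scale 4 socle = - (gen_a * p * gen_a)"
    by (simp add: right_diff_distrib gen_reduce_left a_mult_bac sz mult.assoc)
  \<comment> \<open>The minus sign becomes the scalar -1, so that linearity of
    \<open>socle_coeff\<close> applies.\<close>
  then have "socle_coeff (fk3_scale 4 socle) = socle_coeff (fk3_scale (- 1) (gen_a * p * gen_a))"
    by simp
  then have "fk3_scale 4 (1 :: 'k fk3) = 0"
    by (simp only: map_simps socle_coeff_socle socle_coeff_sandwich fk3.scale_zero_right)
  then have "(4 :: 'k) = 0"
    by simp
  moreover have "(4 :: 'k) = 2 * 2"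
    by simp
  ultimately show False
    using numeral_2_neq_0[OF char] by (metis mult_eq_0_iff)
qed

theorem proposition4p15:
  assumes "CHAR('k::field) \<noteq> 2" and "CHAR('k) \<noteq> 3"
  shows "(\<nexists>\<Delta> :: 'k hh \<Rightarrow> 'k hh. generates_bracket \<Delta>) \<and>
    (\<nexists>\<Delta> :: 'k hh \<Rightarrow> 'k hh. batalin_vilkovisky \<Delta>)"
  using not_generates_bracket[OF assms(1)] by (simp add: batalin_vilkovisky_def)

end
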